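(* Let $K_1, K_2$ be infinite compact Hausdorff spaces and let $E_1,E_2$ be nonzero Banach spaces with nontrivial cotype such that $\mathcal{C}(K_1,E_1)$ is isomorphic to $\mathcal{C}(K_2,E_2)$. Then for each ordinal $\alpha$, $$\min_{\beta<\omega^{\alpha}}c_{\text{pb}}(K_1^{(\beta)},K_1)=\min_{\beta<\omega^{\alpha}}c_{\text{pb}}(K_2^{(\beta)},K_2).$$ In particular, $c(K_1)=c(K_2)$ and $c_{\text{pb}}(K_1^{(\infty)},K_1)=c_{\text{pb}}(K_2^{(\infty)},K_2)$.
   Context: All topological spaces are Hausdorff. For a compact space $K$ and a Banach space $E$, $\mathcal{C}(K,E)$ is the Banach space of continuous functions $K\to E$ with the sup-norm. Isomorphic means linearly homeomorphic. Cantor-Bendixson derivatives: $X^{(0)}=X$, $X^{(1)}$ is the set of accumulation points of $X$, $X^{(\beta+1)}=(X^{(\beta)})^{(1)}$, and $X^{(\alpha)}=\bigcap_{\beta<\alpha}X^{(\beta)}$ for limit ordinals $\alpha$. The perfect kernel $X^{(\infty)}$ is the eventual value $X^{(\alpha)}$, where $\alpha$ is such that $X^{(\alpha)}=X^{(\beta)}$ for all $\beta>\alpha$. Powers $\omega^\alpha$ are ordinal powers. A family $\mathcal{U}$ of nonempty subsets of a topological space $X$ is point-bounded if there is $k\in\mathbb{N}$ such that every $x\in X$ lies in at most $k$ sets from $\mathcal{U}$. The family $\mathcal{U}$ is meeting $A\subseteq X$ if $A\cap U\ne\emptyset$ for each $U\in\mathcal{U}$. For $A\subseteq X$, $c_{\text{pb}}(A,X)$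 is the supremum of the cardinalities $|\mathcal{U}|$ over all point-bounded families $\mathcal{U}$ of nonempty open subsets of $X$ that are meeting $A$. The cellularity $c(X)$ is the supremum of the cardinalities of families of pairwise disjoint nonempty open subsets of $X$. A Banach space $E$ has nontrivial cotype if there are a real number $q\ge 2$ and a constant $C>0$ such that for all $n\in\mathbb{N}$ and $e_1,\dots,e_n\in E$, $\left(\sum_{i=1}^n\|e_i\|^q\right)^{1/q}\le C\left(\int_0^1\left\|\sum_{i=1}^n r_i(t)e_i\right\|^2dt\right)^{1/2}$, where $r_i(t)=\operatorname{sign}(\sin(2^i\pi t))$ are the Rademacher functions. *)

theory Defs
  imports
    "HOL-Analysis.Analysis"
    (* for the HOL-Cardinals theories below it: worecZSL, cardinal arithmetic *)
    "HOL-Algebra.Free_Abelian_Groups"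
begin

text \<open>Ordinals are well-orders; an element \<open>a\<close> of the field of a well-order \<open>r\<close>
  stands for the ordinal given by the proper initial segment \<open>underS r a\<close>. Thus the ordinals
  smaller than \<open>r\<close> are exactly those represented by the elements of \<open>Field r\<close>.
  Cardinals are the \<open>Card_order\<close> relations, compared by \<open>\<le>o\<close> and \<open>=o\<close>.\<close>

text \<open>Ordinal power \<open>\<omega>\<^sup>\<alpha>\<close> (Cantor normal form): a finitely supported
  \<open>f : \<alpha> \<rightarrow> \<omega>\<close> stands for the finite sum of the terms \<open>\<omega>\<^sup>x \<cdot> f x\<close> in
  decreasing order of \<open>x\<close>, so two such functions are compared at the largest argument at
  which they differ.\<close>

definition omega_power :: "'o rel \<Rightarrow> ('o \<Rightarrow> nat) rel" where
  "omega_power \<alpha> =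
     (let F = {f. finite {x. f x \<noteq> 0} \<and> {x. f x \<noteq> 0} \<subseteq> Field \<alpha>} in
      {(f, g). f \<in> F \<and> g \<in> F \<and>
        (f = g \<or> (\<exists>m. f m < g m \<and> (\<forall>x. (m, x) \<in> \<alpha> \<and> x \<noteq> m \<longrightarrow> f x = g x)))})"

text \<open>Accumulation points of the subspace \<open>S\<close>.\<close>

definition derived :: "'a::topological_space set \<Rightarrow> 'a set" where
  "derived S = {x \<in> S. x islimpt S}"

definition cb_derivative :: "'o rel \<Rightarrow> 'o \<Rightarrow> 'a::topological_space set" where
  "cb_derivative r = worecZSL r UNIV (\<lambda>_ S. derived S) (\<lambda>D a. \<Inter>b\<in>underS r a. D b)"

lemma cb_derivative_zero:
  assumes "Well_order r"
  shows "cb_derivative r (zero r) = UNIV"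
proof -
  interpret wo_rel r by (simp add: wo_rel_def assms)
  have "adm_woL (\<lambda>D a. \<Inter>b\<in>underS a. D b)"
    by (auto simp: adm_woL_def)
  then show ?thesis
    unfolding cb_derivative_def by (rule worecZSL_zero)
qed

lemma cb_derivative_succ:
  assumes "Well_order r" and "aboveS r b \<noteq> {}"
  shows "cb_derivative r (succ r b) = derived (cb_derivative r b)"
proof -
  interpret wo_rel r by (simp add: wo_rel_def assms)
  have "adm_woL (\<lambda>D a. \<Inter>b\<in>underS a. D b)"
    by (auto simp: adm_woL_def)
  then show ?thesis
    unfolding cb_derivative_def using assms(2) by (rule worecZSL_succ)
qed

lemma cb_derivative_limit:
  assumes "Well_order r" and "isLim r a" and "a \<noteq> zero r"
  shows "cb_derivative r a = (\<Inter>b\<in>underS r a. cb_derivative r b)"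
proof -
  interpret wo_rel r by (simp add: wo_rel_def assms)
  have "adm_woL (\<lambda>D a. \<Inter>b\<in>underS a. D b)"
    by (auto simp: adm_woL_def)
  then show ?thesis
    unfolding cb_derivative_def using assms(2,3) by (rule worecZSL_isLim)
qed

text \<open>The derivatives of a space on the type \<open>'a\<close> strictly decrease until they become
  constant, so this happens at an ordinal below the successor cardinal of the cardinality of
  \<open>'a\<close>; hence the ordinals below the cardinal of the power set of \<open>'a\<close> suffice.\<close>

definition perfect_kernel :: "'a::topological_space set" where
  "perfect_kernel =
     (let r = |UNIV :: 'a set set| in
      THE S. \<exists>a\<in>Field r. cb_derivative r a = S \<and>
               (\<forall>b. (a, b) \<in> r \<longrightarrow> cb_derivative r b = S))"

text \<open>Suprema and minima of sets of cardinals, determined up to \<open>=o\<close>. The supremum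
  exists as soon as the cardinals are those of sets over \<open>'a\<close>, which are all bounded by
  the cardinal of \<open>'a\<close>.\<close>

definition is_card_sup :: "'a rel set \<Rightarrow> 'a rel \<Rightarrow> bool" where
  "is_card_sup C k \<longleftrightarrow> Card_order k \<and> (\<forall>c\<in>C. c \<le>o k) \<and>
     (\<forall>k' :: 'a rel. Card_order k' \<and> (\<forall>c\<in>C. c \<le>o k') \<longrightarrow> k \<le>o k')"

definition card_sup :: "'a rel set \<Rightarrow> 'a rel" where
  "card_sup C = (SOME k. is_card_sup C k)"

definition card_min :: "'a rel set \<Rightarrow> 'a rel" where
  "card_min C = (SOME k. k \<in> C \<and> (\<forall>c\<in>C. k \<le>o c))"

lemma is_card_sup_card_sup:
  assumes "\<And>c. c \<in> C \<Longrightarrow> Card_order c"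
  shows "is_card_sup C (card_sup C)"
proof -
  let ?B = "{k :: 'a rel. Card_order k \<and> (\<forall>c\<in>C. c \<le>o k)}"
  have "c \<le>o |UNIV :: 'a set|" if "c \<in> C" for c
    using card_of_Field_ordIso[OF assms[OF that]] card_of_mono1[OF subset_UNIV]
      ordIso_ordLeq_trans ordIso_symmetric by blast
  then have "?B \<noteq> {}"
    using card_of_Card_order by blast
  then have "\<exists>k\<in>?B. \<forall>k'\<in>?B. k \<le>o k'"
    by (rule exists_minim_Card_order) auto
  then have "\<exists>k. is_card_sup C k"
    unfolding is_card_sup_def by blast
  then show ?thesis
    unfolding card_sup_def by (rule someI_ex)
qed

lemma card_min_least:
  assumes "C \<noteq> {}" and "\<And>c. c \<in> C \<Longrightarrow> Card_order c"
  shows "card_min C \<in> C" and "c \<in> C \<Longrightarrow> card_min C \<le>o c"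
proof -
  have "\<exists>k. k \<in> C \<and> (\<forall>c\<in>C. k \<le>o c)"
    using exists_minim_Card_order[of C] assms by blast
  then have "card_min C \<in> C \<and> (\<forall>c\<in>C. card_min C \<le>o c)"
    unfolding card_min_def by (rule someI_ex)
  then show "card_min C \<in> C" and "c \<in> C \<Longrightarrow> card_min C \<le>o c"
    by auto
qed

definition point_bounded :: "'a set set \<Rightarrow> bool" where
  "point_bounded \<U> \<longleftrightarrow>
     (\<exists>k::nat. \<forall>x. finite {U \<in> \<U>. x \<in> U} \<and> card {U \<in> \<U>. x \<in> U} \<le> k)"

definition c_pb :: "'a::topological_space set \<Rightarrow> 'a set rel" where
  "c_pb A = card_sup {|\<U>| |\<U>. (\<forall>U\<in>\<U>. open U \<and> U \<noteq> {}) \<and> point_bounded \<U> \<and>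
                               (\<forall>U\<in>\<U>. A \<inter> U \<noteq> {})}"

definition cellularity :: "'a::topological_space itself \<Rightarrow> 'a set rel" where
  "cellularity _ = card_sup {|\<U>| |\<U>::'a set set. (\<forall>U\<in>\<U>. open U \<and> U \<noteq> {}) \<and> disjoint \<U>}"

definition rademacher :: "nat \<Rightarrow> real \<Rightarrow> real" where
  "rademacher i t = sgn (sin (2 ^ i * pi * t))"

definition nontrivial_cotype :: "'e::real_normed_vector itself \<Rightarrow> bool" where
  "nontrivial_cotype _ \<longleftrightarrow>
     (\<exists>q C :: real. q \<ge> 2 \<and> C > 0 \<and>
       (\<forall>(n::nat) (e :: nat \<Rightarrow> 'e).
          (\<Sum>i=1..n. norm (e i) powr q) powr (1 / q)
            \<le> C * sqrt (integral {0..1} (\<lambda>t. (norm (\<Sum>i=1..n. rademacher i t *\<^sub>R e i))\<^sup>2))))"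

definition isomorphic_normed ::
  "'v::real_normed_vector itself \<Rightarrow> 'w::real_normed_vector itself \<Rightarrow> bool" where
  "isomorphic_normed _ _ \<longleftrightarrow>
     (\<exists>(T :: 'v \<Rightarrow> 'w) S. linear T \<and> homeomorphism UNIV UNIV T S)"

end

(*
  Both inequalities come from one estimate for an embedding T. Fix a unit vector e and write
  F phi = T (phi e). Functions phi whose supports are point-bounded cannot be large simultaneously
  at one point y under F, by cotype. Hence, in an open set U meeting a derivative of K1, for a finite
  S in K2 there is a bump phi supported in U and equal to 1 near a point of the previous derivative
  with F phi small on S.
  For S of larger Cantor-Bendixson height, choose bumps phi_1, phi_2, ... successively, each supported
  where the preceding one is 1, such that at every y at most one F phi_i is large. Their sum is n
  at some point, whereas F of it is at most |T| + n eps. Averaging therefore gives a bump that F makes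
  small on S, which raises the height that can be handled, first from omega^a k to omega^a (k + 1)
  and by compactness to omega^(a + 1); for the whole of K2 the same sum contradicts the lower bound
  on T unless F phi is large somewhere on the beta-th derivative of K2 for some phi supported in U.
  So a point-bounded family meeting a sufficiently high derivative of K1, still below omega^alpha,
  is carried to a point-bounded family meeting the beta-th derivative of K2.
*)

theory Submission
  imports Defs "HOL-Library.Multiset"
begin

section \<open>Relative Cantor-Bendixson derivatives\<close>

lemma derived_subset: "derived S \<subseteq> S"
  by (auto simp: derived_def)

lemma derived_mono: "A \<subseteq> B \<Longrightarrow> derived A \<subseteq> derived B"
  using islimpt_subset by (auto simp: derived_def)

lemma closed_derived:
  fixes S :: "'a::t1_space set"
  assumes "closed S"
  shows "closed (derived S)"
proof -
  have "\<exists>T. open T \<and> x \<in> T \<and> T \<subseteq> - derived S" if "x \<notin> derived S" for x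
  proof (cases "x \<in> S")
    case False
    then show ?thesis
      using open_Compl[OF assms] derived_subset[of S] by (intro exI[of _ "- S"]) simp
  next
    case True
    then have "\<not> x islimpt S"
      using that by (simp add: derived_def)
    then obtain T where T: "open T" "x \<in> T" "\<And>y. y \<in> S \<Longrightarrow> y \<in> T \<Longrightarrow> y = x"
      by (meson islimptI)
    have "T \<subseteq> - derived S"
    proof
      fix y assume "y \<in> T"
      show "y \<in> - derived S"
      proof (cases "y = x")
        case True
        then show ?thesis using that by simp
      next
        case False
        then show ?thesis
          using T(3) \<open>y \<in> T\<close> derived_subset[of S] by blast
      qed
    qed
    then show ?thesis using T by blast
  qed
  then show ?thesis
    unfolding closed_def by (subst open_subopen) blast
qed

lemma derived_Un_closed:
  assumes "closed A" "closed B"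
  shows "derived (A \<union> B) = derived A \<union> derived B"
proof -
  have "x \<in> A" if "x islimpt A" for x using that assms(1) closed_limpt by metis
  moreover have "x \<in> B" if "x islimpt B" for x using that assms(2) closed_limpt by metis
  ultimately show ?thesis
    by (auto simp: derived_def islimpt_Un)
qed

lemma finite_if_derived_empty:
  assumes "compact S" "derived S = {}"
  shows "finite S"
  using Heine_Borel_imp_Bolzano_Weierstrass[of S S] assms by (auto simp: derived_def)

lemma Well_order_underS_induct:
  assumes "Well_order r" and "\<And>a. (\<And>b. b \<in> underS r a \<Longrightarrow> P b) \<Longrightarrow> P a"
  shows "P a"
proof -
  interpret wo_rel r by (simp add: wo_rel_def assms)
  show ?thesis
    by (rule well_order_induct) (auto intro: assms(2) simp: underS_def)
qed

lemma underS_linear: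
  assumes "Well_order r" "a \<in> Field r" "b \<in> Field r"
  obtains "a = b" | "a \<in> underS r b" | "b \<in> underS r a"
proof -
  interpret wo_rel r by (simp add: wo_rel_def assms)
  show ?thesis
    using assms(2,3) TOTALS that unfolding underS_def by blast
qed

definition rel_derivative :: "'o rel \<Rightarrow> 'a::topological_space set \<Rightarrow> 'o \<Rightarrow> 'a set" where
  "rel_derivative r S =
     wo_rel.worec r (\<lambda>D a. S \<inter> (\<Inter>b\<in>underS r a. derived (D b)))"

lemma rel_derivative_unfold:
  assumes "Well_order r"
  shows "rel_derivative r S a = S \<inter> (\<Inter>b\<in>underS r a. derived (rel_derivative r S b))"
proof -
  interpret wo_rel r by (simp add: wo_rel_def assms)
  have "adm_wo (\<lambda>D a. S \<inter> (\<Inter>b\<in>underS a. derived (D b)))"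
    unfolding adm_wo_def by auto
  from worec_fixpoint[OF this] show ?thesis
    unfolding rel_derivative_def by metis
qed

lemma rel_derivative_subset: "Well_order r \<Longrightarrow> rel_derivative r S a \<subseteq> S"
  by (subst rel_derivative_unfold) auto

lemma rel_derivative_subset_derived:
  "Well_order r \<Longrightarrow> b \<in> underS r a \<Longrightarrow> rel_derivative r S a \<subseteq> derived (rel_derivative r S b)"
  by (subst rel_derivative_unfold) auto

lemma rel_derivative_antimono:
  assumes "Well_order r" "(b, a) \<in> r"
  shows "rel_derivative r S a \<subseteq> rel_derivative r S b"
proof (cases "a = b")
  case False
  then have "b \<in> underS r a" using assms by (simp add: underS_def)
  then show ?thesis
    using rel_derivative_subset_derived[OF assms(1)] derived_subset by blast
qed simp

lemma rel_derivative_mono: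
  assumes "Well_order r" "S \<subseteq> S'"
  shows "rel_derivative r S a \<subseteq> rel_derivative r S' a"
proof (induction a rule: Well_order_underS_induct[OF assms(1)])
  case (1 a)
  then show ?case
    unfolding rel_derivative_unfold[OF assms(1), of _ a]
    using assms(2) by (intro Int_mono INT_anti_mono derived_mono) auto
qed

lemma closed_rel_derivative:
  fixes S :: "'a::t1_space set"
  assumes "Well_order r" "closed S"
  shows "closed (rel_derivative r S a)"
proof (induction a rule: Well_order_underS_induct[OF assms(1)])
  case (1 a)
  then show ?case
    unfolding rel_derivative_unfold[OF assms(1), of _ a]
    using assms(2) closed_derived by (intro closed_Int closed_INT) auto
qed

lemma rel_derivative_Un:
  fixes A B :: "'a::t1_space set"
  assumes WO: "Well_order r" and "closed A" "closed B"
  shows "rel_derivative r (A \<union> B) a \<subseteq> rel_derivative r A a \<union> rel_derivative r B a"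
proof (induction a rule: Well_order_underS_induct[OF WO])
  case (1 a)
  let ?D = "rel_derivative r"
  show ?case
  proof
    fix p assume p: "p \<in> ?D (A \<union> B) a"
    have step: "p \<in> derived (?D A b) \<or> p \<in> derived (?D B b)" if "b \<in> underS r a" for b
    proof -
      have "p \<in> derived (?D (A \<union> B) b)"
        using p rel_derivative_subset_derived[OF WO that] by blast
      then have "p \<in> derived (?D A b \<union> ?D B b)"
        using derived_mono[OF 1[OF that]] by blast
      then show ?thesis
        by (simp add: derived_Un_closed closed_rel_derivative assms)
    qed
    show "p \<in> ?D A a \<union> ?D B a"
    proof (rule ccontr)
      assume np: "p \<notin> ?D A a \<union> ?D B a"
      have pAB: "p \<in> A \<or> p \<in> B"
        using p rel_derivative_subset[OF WO] by blast
      have out: "p \<notin> derived (?D X b)" if "p \<notin> X" for X b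
        using that rel_derivative_subset[OF WO, of X b] derived_subset by blast
      have "p \<in> A \<and> p \<in> B"
        using np pAB step out rel_derivative_unfold[OF WO, of A a]
          rel_derivative_unfold[OF WO, of B a] by auto
      then obtain b c where b: "b \<in> underS r a" "p \<notin> derived (?D A b)"
        and c: "c \<in> underS r a" "p \<notin> derived (?D B c)"
        using np rel_derivative_unfold[OF WO, of A a]
          rel_derivative_unfold[OF WO, of B a] by auto
      have anti: "derived (?D X y) \<subseteq> derived (?D X x)" if "x \<in> underS r y" for X x y
        using that rel_derivative_antimono[OF WO] derived_mono by (metis underS_E)
      have "b \<in> Field r" "c \<in> Field r"
        using b(1) c(1) by (auto simp: underS_def Field_def)
      then consider "b = c" | "b \<in> underS r c" | "c \<in> underS r b"
        using underS_linear[OF WO] by metis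
      then show False
      proof cases
        case 1
        then show False using b(2) c(2) step[OF b(1)] by simp
      next
        case 2
        then show False using anti[of b c A] b(2) c step[OF c(1)] by blast
      next
        case 3
        then show False using anti[of c b B] c(2) b step[OF b(1)] by blast
      qed
    qed
  qed
qed

lemma cb_derivative_eq_rel_derivative:
  assumes WO: "Well_order r"
  shows "cb_derivative r a = rel_derivative r UNIV a"
proof -
  interpret wo_rel r by (simp add: wo_rel_def assms)
  show ?thesis
  proof (induction a rule: well_order_inductZSL)
    case Zero
    show ?case
      by (simp add: cb_derivative_zero[OF WO] rel_derivative_unfold[OF WO, of _ zero])
  next
    case (Suc b)
    have "b \<in> underS (succ b)"
      using succ_in[OF Suc(1)] succ_diff[OF Suc(1)] by (metis underS_I)
    then have "rel_derivative r UNIV (succ b) \<subseteq> derived (rel_derivative r UNIV b)"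
      by (rule rel_derivative_subset_derived[OF WO])
    moreover have "derived (rel_derivative r UNIV b) \<subseteq> derived (rel_derivative r UNIV c)"
      if "c \<in> underS (succ b)" for c
    proof -
      have "(c, b) \<in> r"
        using that Suc(1) by (simp add: under_def)
      then show ?thesis
        by (intro derived_mono rel_derivative_antimono[OF WO])
    qed
    then have "derived (rel_derivative r UNIV b) \<subseteq> rel_derivative r UNIV (succ b)"
      unfolding rel_derivative_unfold[OF WO, of _ "succ b"] by blast
    ultimately show ?case
      using cb_derivative_succ[OF WO Suc(1)] Suc(2) by auto
  next
    case (Lim a)
    have "rel_derivative r UNIV a \<subseteq> (\<Inter>b\<in>underS a. rel_derivative r UNIV b)"
      using rel_derivative_antimono[OF WO] by (intro INT_greatest) (auto simp: underS_def)
    moreover have "(\<Inter>b\<in>underS a. rel_derivative r UNIV b) \<subseteq> derived (rel_derivative r UNIV c)"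
      if c: "c \<in> underS a" for c
    proof -
      obtain k where "k \<in> underS a" "c \<in> underS k"
        using isLim_iff[OF Lim(1) c] by blast
      then show ?thesis
        using rel_derivative_subset_derived[OF WO, of c k UNIV] by blast
    qed
    then have "(\<Inter>b\<in>underS a. rel_derivative r UNIV b) \<subseteq> rel_derivative r UNIV a"
      unfolding rel_derivative_unfold[OF WO, of _ a] by blast
    ultimately show ?case
      using cb_derivative_limit[OF WO Lim(1,2)] Lim(3) by auto
  qed
qed

section \<open>Derivatives indexed by powers of omega\<close>

lemma finite_has_greatest:
  assumes "Well_order r" "finite A" "A \<noteq> {}" "A \<subseteq> Field r"
  shows "\<exists>m\<in>A. \<forall>x\<in>A. (x, m) \<in> r"
proof -
  interpret wo_rel r by (simp add: wo_rel_def assms)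
  show ?thesis
    using assms(2-4)
  proof (induction rule: finite_ne_induct)
    case (singleton x)
    then show ?case using REFL by (simp add: refl_on_def)
  next
    case (insert x A)
    then obtain m where m: "m \<in> A" "\<forall>x\<in>A. (x, m) \<in> r" by auto
    have "x \<in> Field r" "m \<in> Field r" using insert m by auto
    then consider "(x, m) \<in> r" | "(m, x) \<in> r" using TOTALS by blast
    then show ?case
    proof cases
      case 1
      then show ?thesis using m by blast
    next
      case 2
      then have "\<forall>y\<in>insert x A. (y, x) \<in> r"
        using m TRANS \<open>x \<in> Field r\<close> REFL unfolding trans_def refl_on_def by blast
      then show ?thesis by blast
    qed
  qed
qed

definition omega_power_less :: "'o rel \<Rightarrow> ('o \<Rightarrow> nat) \<Rightarrow> ('o \<Rightarrow> nat) \<Rightarrow> bool" where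
  "omega_power_less \<alpha> f g \<longleftrightarrow> (\<exists>m. f m < g m \<and> (\<forall>x. (m, x) \<in> \<alpha> \<and> x \<noteq> m \<longrightarrow> f x = g x))"

lemma Field_omega_power:
  "Field (omega_power \<alpha>) = {f. finite {x. f x \<noteq> 0} \<and> {x. f x \<noteq> 0} \<subseteq> Field \<alpha>}"
  unfolding omega_power_def Let_def Field_def by fast

lemma omega_power_iff:
  "(f, g) \<in> omega_power \<alpha> \<longleftrightarrow>
     f \<in> Field (omega_power \<alpha>) \<and> g \<in> Field (omega_power \<alpha>) \<and> (f = g \<or> omega_power_less \<alpha> f g)"
  unfolding Field_omega_power unfolding omega_power_def omega_power_less_def Let_def by simp

lemma omega_power_less_total:
  assumes WO: "Well_order \<alpha>" and "f \<in> Field (omega_power \<alpha>)" "g \<in> Field (omega_power \<alpha>)" "f \<noteq> g"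
  shows "omega_power_less \<alpha> f g \<or> omega_power_less \<alpha> g f"
proof -
  interpret wo_rel \<alpha> by (simp add: wo_rel_def WO)
  let ?A = "{x. f x \<noteq> g x}"
  have sub: "?A \<subseteq> {x. f x \<noteq> 0} \<union> {x. g x \<noteq> 0}" by auto
  then have "finite ?A" "?A \<subseteq> Field \<alpha>"
    using assms(2,3) unfolding Field_omega_power by (auto intro: finite_subset)
  moreover have "?A \<noteq> {}" using assms(4) by auto
  ultimately obtain m where m: "m \<in> ?A" "\<forall>x\<in>?A. (x, m) \<in> \<alpha>"
    using finite_has_greatest[OF WO] by meson
  have "f x = g x" if "(m, x) \<in> \<alpha>" "x \<noteq> m" for x
    using that m(2) ANTISYM unfolding antisym_def by blast
  moreover have "f m < g m \<or> g m < f m" using m(1) by auto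
  ultimately show ?thesis unfolding omega_power_less_def by metis
qed

lemma omega_power_less_trans:
  assumes WO: "Well_order \<alpha>"
    and F: "f \<in> Field (omega_power \<alpha>)" "g \<in> Field (omega_power \<alpha>)" "h \<in> Field (omega_power \<alpha>)"
    and "omega_power_less \<alpha> f g" "omega_power_less \<alpha> g h"
  shows "omega_power_less \<alpha> f h"
proof -
  interpret wo_rel \<alpha> by (simp add: wo_rel_def WO)
  obtain m where m: "f m < g m" "\<And>x. (m, x) \<in> \<alpha> \<Longrightarrow> x \<noteq> m \<Longrightarrow> f x = g x"
    using assms(5) unfolding omega_power_less_def by blast
  obtain n where n: "g n < h n" "\<And>x. (n, x) \<in> \<alpha> \<Longrightarrow> x \<noteq> n \<Longrightarrow> g x = h x"
    using assms(6) unfolding omega_power_less_def by blast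
  have "m \<in> Field \<alpha>" "n \<in> Field \<alpha>"
    using m(1) n(1) F unfolding Field_omega_power by force+
  then consider "m = n" | "(m, n) \<in> \<alpha>" "m \<noteq> n" | "(n, m) \<in> \<alpha>" "m \<noteq> n"
    using TOTALS by blast
  then show ?thesis
  proof cases
    case 1
    then show ?thesis using m n unfolding omega_power_less_def
      by (metis less_trans)
  next
    case 2
    have "f x = h x" if "(n, x) \<in> \<alpha>" "x \<noteq> n" for x
    proof -
      have "(m, x) \<in> \<alpha>" using transD[OF TRANS 2(1) that(1)] .
      moreover have "x \<noteq> m" using that 2 antisymD[OF ANTISYM] by blast
      ultimately show ?thesis using m(2) n(2)[OF that] by simp
    qed
    moreover have "f n < h n" using m(2)[OF 2(1)] 2(2) n(1) by simp
    ultimately show ?thesis unfolding omega_power_less_def by blast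
  next
    case 3
    have "f x = h x" if "(m, x) \<in> \<alpha>" "x \<noteq> m" for x
    proof -
      have "(n, x) \<in> \<alpha>" using transD[OF TRANS 3(1) that(1)] .
      moreover have "x \<noteq> n" using that 3 antisymD[OF ANTISYM] by blast
      ultimately show ?thesis using n(2) m(2)[OF that] by simp
    qed
    moreover have "f m < h m" using n(2)[OF 3(1)] 3(2) m(1) by simp
    ultimately show ?thesis unfolding omega_power_less_def by blast
  qed
qed

text \<open>The multiset extension of a well-founded order is well-founded, and \<open>omega_power \<alpha>\<close>
  embeds into that of \<open>\<alpha>\<close>.\<close>

lemma wf_omega_power:
  assumes WO: "Well_order \<alpha>"
  shows "wf (omega_power \<alpha> - Id)"
proof -
  interpret wo_rel \<alpha> by (simp add: wo_rel_def WO)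
  have "omega_power \<alpha> - Id \<subseteq> inv_image (Multiset.mult (\<alpha> - Id)) Abs_multiset"
  proof (rule subrelI)
    fix f g assume fg: "(f, g) \<in> omega_power \<alpha> - Id"
    then have F: "finite {x. f x \<noteq> 0}" "finite {x. g x \<noteq> 0}"
        "{x. f x \<noteq> 0} \<subseteq> Field \<alpha>" "{x. g x \<noteq> 0} \<subseteq> Field \<alpha>"
      by (auto simp: omega_power_iff Field_omega_power)
    obtain m where m: "f m < g m" "\<And>x. (m, x) \<in> \<alpha> \<Longrightarrow> x \<noteq> m \<Longrightarrow> f x = g x"
      using fg by (auto simp: omega_power_iff omega_power_less_def)
    define P where "P = Abs_multiset f"
    define Q where "Q = Abs_multiset g"
    have P: "count P = f" and Q: "count Q = g"
      using F unfolding P_def Q_def by simp_all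
    have "((P \<inter># Q) + (P - Q), (P \<inter># Q) + (Q - P)) \<in> Multiset.mult (\<alpha> - Id)"
    proof (rule one_step_implies_mult)
      have mQ: "m \<in># Q - P" using m(1) P Q by (simp add: in_diff_count)
      then show "Q - P \<noteq> {#}" by auto
      show "\<forall>k\<in>#P - Q. \<exists>j\<in>#Q - P. (k, j) \<in> \<alpha> - Id"
      proof
        fix k assume "k \<in># P - Q"
        then have k: "g k < f k" using P Q by (simp add: in_diff_count)
        have "k \<in> Field \<alpha>" "m \<in> Field \<alpha>" using k m(1) F by force+
        moreover have "k \<noteq> m" using k m(1) by auto
        moreover have "(m, k) \<notin> \<alpha>" using m(2)[of k] k \<open>k \<noteq> m\<close> by auto
        ultimately have "(k, m) \<in> \<alpha> - Id" using TOTALS by blast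
        then show "\<exists>j\<in>#Q - P. (k, j) \<in> \<alpha> - Id" using mQ by blast
      qed
    qed
    moreover have "(P \<inter># Q) + (P - Q) = P" "(P \<inter># Q) + (Q - P) = Q"
      by (auto simp: multiset_eq_iff min_def)
    ultimately show "(f, g) \<in> inv_image (Multiset.mult (\<alpha> - Id)) Abs_multiset"
      by (simp add: inv_image_def P_def Q_def)
  qed
  then show ?thesis
    by (rule wf_subset[OF wf_inv_image[OF wf_mult[OF WF]]])
qed

lemma Well_order_omega_power:
  assumes WO: "Well_order \<alpha>"
  shows "Well_order (omega_power \<alpha>)"
proof -
  let ?W = "omega_power \<alpha>"
  have irrefl: "\<not> omega_power_less \<alpha> f f" for f
    by (auto simp: omega_power_less_def)
  have "refl_on (Field ?W) ?W"
    by (auto simp: refl_on_def omega_power_iff)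
  moreover have "trans ?W"
    unfolding trans_def omega_power_iff using omega_power_less_trans[OF WO] by blast
  moreover have "antisym ?W"
    unfolding antisym_def omega_power_iff using omega_power_less_trans[OF WO] irrefl by blast
  moreover have "total_on (Field ?W) ?W"
    unfolding total_on_def omega_power_iff using omega_power_less_total[OF WO] by blast
  moreover have "?W \<subseteq> Field ?W \<times> Field ?W"
    by (auto simp: Field_def)
  ultimately show ?thesis
    using wf_omega_power[OF WO]
    by (simp add: well_order_on_def linear_order_on_def partial_order_on_def preorder_on_def)
qed

lemma underS_omega_power_iff:
  "f \<in> underS (omega_power \<alpha>) g \<longleftrightarrow>
     f \<in> Field (omega_power \<alpha>) \<and> g \<in> Field (omega_power \<alpha>) \<and> omega_power_less \<alpha> f g"
  unfolding underS_def omega_power_iff by (auto simp: omega_power_less_def)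

lemma omega_power_add_Field:
  assumes "f \<in> Field (omega_power \<alpha>)" "g \<in> Field (omega_power \<alpha>)"
  shows "(\<lambda>i. f i + g i) \<in> Field (omega_power \<alpha>)"
proof -
  have "{x. f x + g x \<noteq> 0} = {x. f x \<noteq> 0} \<union> {x. g x \<noteq> 0}" by auto
  then show ?thesis using assms unfolding Field_omega_power by simp
qed

lemma omega_power_le_add:
  assumes WO: "Well_order \<alpha>" and "f \<in> Field (omega_power \<alpha>)" "g \<in> Field (omega_power \<alpha>)"
  shows "(g, \<lambda>i. f i + g i) \<in> omega_power \<alpha>"
proof -
  have "\<not> omega_power_less \<alpha> (\<lambda>i. f i + g i) g"
    by (auto simp: omega_power_less_def)
  then have "g = (\<lambda>i. f i + g i) \<or> omega_power_less \<alpha> g (\<lambda>i. f i + g i)"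
    using omega_power_less_total[OF WO assms(3) omega_power_add_Field[OF assms(2,3)]] by blast
  then show ?thesis
    unfolding omega_power_iff using assms(3) omega_power_add_Field[OF assms(2,3)] by blast
qed

text \<open>Since \<open>f \<mapsto> f + g\<close> is strictly increasing with all values at least \<open>g\<close>, the pointwise sum
  bounds the ordinal sum from above.\<close>

lemma rel_derivative_add:
  assumes WO: "Well_order \<alpha>"
    and "f \<in> Field (omega_power \<alpha>)" and g: "g \<in> Field (omega_power \<alpha>)"
  shows "rel_derivative (omega_power \<alpha>) S (\<lambda>i. f i + g i)
      \<subseteq> rel_derivative (omega_power \<alpha>) (rel_derivative (omega_power \<alpha>) S g) f"
  using assms(2)
proof (induction f rule: Well_order_underS_induct[OF Well_order_omega_power[OF WO]])
  case (1 f)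
  note W = Well_order_omega_power[OF WO]
  let ?D = "rel_derivative (omega_power \<alpha>)"
  have "?D S (\<lambda>i. f i + g i) \<subseteq> derived (?D (?D S g) h)" if h: "h \<in> underS (omega_power \<alpha>) f" for h
  proof -
    have hF: "h \<in> Field (omega_power \<alpha>)" using h by (simp add: underS_omega_power_iff)
    have "(\<lambda>i. h i + g i) \<in> underS (omega_power \<alpha>) (\<lambda>i. f i + g i)"
      using h omega_power_add_Field[OF hF g] omega_power_add_Field[OF 1(2) g]
      by (simp add: underS_omega_power_iff omega_power_less_def)
    then have "?D S (\<lambda>i. f i + g i) \<subseteq> derived (?D S (\<lambda>i. h i + g i))"
      by (rule rel_derivative_subset_derived[OF W])
    also have "\<dots> \<subseteq> derived (?D (?D S g) h)"
      by (rule derived_mono[OF 1(1)[OF h hF]])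
    finally show ?thesis .
  qed
  moreover have "?D S (\<lambda>i. f i + g i) \<subseteq> ?D S g"
    using rel_derivative_antimono[OF W omega_power_le_add[OF WO 1(2) g]] .
  ultimately show ?case
    unfolding rel_derivative_unfold[OF W, of _ f] by blast
qed

lemma rel_derivative_mult:
  assumes WO: "Well_order \<alpha>" and g: "g \<in> Field (omega_power \<alpha>)"
  shows "(\<lambda>i. n * g i) \<in> Field (omega_power \<alpha>) \<and> rel_derivative (omega_power \<alpha>) S (\<lambda>i. n * g i)
      \<subseteq> ((\<lambda>S. rel_derivative (omega_power \<alpha>) S g) ^^ n) S"
proof (induction n arbitrary: S)
  case 0
  then show ?case
    using rel_derivative_subset[OF Well_order_omega_power[OF WO]] by (simp add: Field_omega_power)
next
  case (Suc n)
  have eq: "(\<lambda>i. Suc n * g i) = (\<lambda>i. n * g i + g i)" by auto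
  let ?D = "rel_derivative (omega_power \<alpha>)"
  have "?D S (\<lambda>i. Suc n * g i) \<subseteq> ?D (?D S g) (\<lambda>i. n * g i)"
    unfolding eq using rel_derivative_add[OF WO conjunct1[OF Suc] g] .
  also have "\<dots> \<subseteq> ((\<lambda>S. ?D S g) ^^ n) (?D S g)"
    using Suc by blast
  finally show ?case
    unfolding funpow_Suc_right o_apply eq using omega_power_add_Field[OF conjunct1[OF Suc] g] by simp
qed

definition omega_pow :: "'o \<Rightarrow> 'o \<Rightarrow> nat" where
  "omega_pow a = (\<lambda>i. if i = a then 1 else 0)"

lemma omega_pow_simps [simp]: "omega_pow a a = 1" "i \<noteq> a \<Longrightarrow> omega_pow a i = 0"
  by (auto simp: omega_pow_def)

lemma omega_pow_Field: "a \<in> Field \<alpha> \<Longrightarrow> omega_pow a \<in> Field (omega_power \<alpha>)"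
  by (auto simp: Field_omega_power omega_pow_def)

lemma omega_power_leading_exponent:
  assumes WO: "Well_order \<alpha>" and "f \<in> Field (omega_power \<alpha>)" "f \<noteq> (\<lambda>_. 0)"
  obtains a where "a \<in> Field \<alpha>" "f a \<noteq> 0" "\<And>i. f i \<noteq> 0 \<Longrightarrow> (i, a) \<in> \<alpha>"
  using finite_has_greatest[OF WO, of "{x. f x \<noteq> 0}"] assms(2,3)
  unfolding Field_omega_power by blast

lemma omega_power_less_omega_pow:
  assumes WO: "Well_order \<alpha>" and f: "f \<in> Field (omega_power \<alpha>)" and a: "a \<in> Field \<alpha>"
    and "f a = 0" "\<And>i. f i \<noteq> 0 \<Longrightarrow> (i, a) \<in> \<alpha>"
  shows "f \<in> underS (omega_power \<alpha>) (omega_pow a)"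
proof -
  interpret wo_rel \<alpha> by (simp add: wo_rel_def WO)
  have "f x = 0" if "(a, x) \<in> \<alpha>" "x \<noteq> a" for x
    using that assms(5) antisymD[OF ANTISYM] by blast
  then show ?thesis
    using assms(4) f omega_pow_Field[OF a]
    unfolding underS_omega_power_iff omega_power_less_def by (auto intro!: exI[of _ a])
qed

lemma rel_derivative_omega_pow_add:
  assumes WO: "Well_order \<alpha>" and a: "a \<in> Field \<alpha>"
    and "f \<in> Field (omega_power \<alpha>)" "\<And>i. f i \<noteq> 0 \<Longrightarrow> (i, a) \<in> \<alpha>"
  shows "rel_derivative (omega_power \<alpha>) (rel_derivative (omega_power \<alpha>) S (omega_pow a)) f
      \<subseteq> rel_derivative (omega_power \<alpha>) S (\<lambda>i. f i + omega_pow a i)"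
  using assms(3,4)
proof (induction f rule: Well_order_underS_induct[OF Well_order_omega_power[OF WO]])
  case (1 f)
  interpret wo_rel \<alpha> by (simp add: wo_rel_def WO)
  note W = Well_order_omega_power[OF WO]
  let ?D = "rel_derivative (omega_power \<alpha>)"
  let ?T = "?D (?D S (omega_pow a)) f"
  have "?T \<subseteq> derived (?D S g)"
    if g: "g \<in> Order_Relation.underS (omega_power \<alpha>) (\<lambda>i. f i + omega_pow a i)" for g
  proof -
    have gF: "g \<in> Field (omega_power \<alpha>)" using g by (simp add: underS_omega_power_iff)
    obtain m where m: "g m < f m + omega_pow a m"
      and eq: "\<And>x. (m, x) \<in> \<alpha> \<Longrightarrow> x \<noteq> m \<Longrightarrow> g x = f x + omega_pow a x"
      using g by (auto simp: underS_omega_power_iff omega_power_less_def)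
    have ma: "(m, a) \<in> \<alpha>"
    proof (cases "m = a")
      case True
      then show ?thesis using a REFL by (simp add: refl_on_def)
    next
      case False
      then show ?thesis using m 1(3)[of m] by simp
    qed
    have supp: "(i, a) \<in> \<alpha>" if "g i \<noteq> 0" for i
    proof (rule ccontr)
      assume i: "(i, a) \<notin> \<alpha>"
      then have "i \<noteq> a" using a REFL by (auto simp: refl_on_def)
      have "i \<in> Field \<alpha>" using that gF by (auto simp: Field_omega_power)
      then have "(a, i) \<in> \<alpha>" using i a TOTALS by blast
      then have "(m, i) \<in> \<alpha>" using transD[OF TRANS ma] by blast
      moreover have "i \<noteq> m" using i ma by auto
      ultimately have "g i = f i" using eq[of i] \<open>i \<noteq> a\<close> by simp
      then show False using that 1(3) i by auto
    qed
    show ?thesis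
    proof (cases "g a = 0")
      case True
      have "?T \<subseteq> ?D S (omega_pow a)" by (rule rel_derivative_subset[OF W])
      also have "\<dots> \<subseteq> derived (?D S g)"
        by (intro rel_derivative_subset_derived[OF W] omega_power_less_omega_pow WO gF a True supp)
      finally show ?thesis .
    next
      case False
      define h where "h = g(a := g a - 1)"
      have gh: "g = (\<lambda>i. h i + omega_pow a i)"
        using False by (auto simp: h_def omega_pow_def)
      have "{x. h x \<noteq> 0} \<subseteq> {x. g x \<noteq> 0}" by (auto simp: h_def split: if_splits)
      then have hF: "h \<in> Field (omega_power \<alpha>)"
        using gF by (auto simp: Field_omega_power intro: finite_subset)
      have "omega_power_less \<alpha> h f"
        using m eq unfolding omega_power_less_def gh by (intro exI[of _ m]) auto
      then have hf: "h \<in> Order_Relation.underS (omega_power \<alpha>) f"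
        using hF 1(2) by (simp add: underS_omega_power_iff)
      have "?T \<subseteq> derived (?D (?D S (omega_pow a)) h)"
        by (rule rel_derivative_subset_derived[OF W hf])
      also have "\<dots> \<subseteq> derived (?D S (\<lambda>i. h i + omega_pow a i))"
        using supp by (intro derived_mono 1(1)[OF hf hF]) (auto simp: gh)
      finally show ?thesis by (simp add: gh)
    qed
  qed
  moreover have "?T \<subseteq> S"
    using rel_derivative_subset[OF W] by blast
  ultimately show ?case
    unfolding rel_derivative_unfold[OF W, of S "\<lambda>i. f i + omega_pow a i"] by blast
qed

lemma funpow_rel_derivative_subset:
  assumes "Well_order r"
  shows "((\<lambda>S. rel_derivative r S a) ^^ n) S \<subseteq> S"
  by (induction n) (use rel_derivative_subset[OF assms] in auto)

lemma funpow_omega_pow_subset: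
  assumes WO: "Well_order \<alpha>" and a: "a \<in> Field \<alpha>"
    and "f \<in> Field (omega_power \<alpha>)" "\<And>i. f i \<noteq> 0 \<Longrightarrow> (i, a) \<in> \<alpha>" "f a < n"
  shows "((\<lambda>S. rel_derivative (omega_power \<alpha>) S (omega_pow a)) ^^ n) S
      \<subseteq> rel_derivative (omega_power \<alpha>) S f"
  using assms(3-5)
proof (induction n arbitrary: f S)
  case (Suc n)
  note W = Well_order_omega_power[OF WO]
  let ?D = "rel_derivative (omega_power \<alpha>)"
  let ?\<tau> = "\<lambda>S. ?D S (omega_pow a)"
  have eq: "(?\<tau> ^^ Suc n) S = (?\<tau> ^^ n) (?\<tau> S)" by (simp only: funpow_Suc_right o_apply)
  show ?case
  proof (cases "f a = 0")
    case True
    have "(?\<tau> ^^ n) (?\<tau> S) \<subseteq> ?\<tau> S" by (rule funpow_rel_derivative_subset[OF W])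
    also have "\<dots> \<subseteq> derived (?D S f)"
      by (intro rel_derivative_subset_derived[OF W] omega_power_less_omega_pow WO Suc.prems a True)
    also have "\<dots> \<subseteq> ?D S f" by (rule derived_subset)
    finally show ?thesis unfolding eq .
  next
    case False
    define h where "h = f(a := f a - 1)"
    have fh: "f = (\<lambda>i. h i + omega_pow a i)"
      using False by (auto simp: h_def omega_pow_def)
    have "{x. h x \<noteq> 0} \<subseteq> {x. f x \<noteq> 0}" by (auto simp: h_def split: if_splits)
    then have hF: "h \<in> Field (omega_power \<alpha>)"
      using Suc.prems(1) by (auto simp: Field_omega_power intro: finite_subset)
    have supp: "(i, a) \<in> \<alpha>" if "h i \<noteq> 0" for i
      using that Suc.prems(2)[of i] by (simp add: fh)
    have "(?\<tau> ^^ n) (?\<tau> S) \<subseteq> ?D (?\<tau> S) h"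
      using Suc.prems(3) False by (intro Suc.IH hF supp) (auto simp: h_def)
    also have "\<dots> \<subseteq> ?D S f"
      unfolding fh by (rule rel_derivative_omega_pow_add[OF WO a hF supp])
    finally show ?thesis unfolding eq .
  qed
qed simp

lemma omega_power_below_omega_pow:
  assumes WO: "Well_order \<alpha>" and "f \<in> underS (omega_power \<alpha>) (omega_pow a)" and "f b \<noteq> 0"
  shows "b \<in> underS \<alpha> a"
proof -
  interpret wo_rel \<alpha> by (simp add: wo_rel_def WO)
  obtain m where m: "f m < omega_pow a m" "\<And>x. (m, x) \<in> \<alpha> \<Longrightarrow> x \<noteq> m \<Longrightarrow> f x = omega_pow a x"
    using assms(2) by (auto simp: underS_omega_power_iff omega_power_less_def)
  have "m = a" using m(1) by (cases "m = a") auto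
  then have fa: "f a = 0" and above: "\<And>x. (a, x) \<in> \<alpha> \<Longrightarrow> x \<noteq> a \<Longrightarrow> f x = 0"
    using m by auto
  have "b \<in> Field \<alpha>"
    using assms(2,3) by (auto simp: underS_omega_power_iff Field_omega_power)
  moreover have "a \<in> Field \<alpha>"
    using assms(2) by (force simp: underS_omega_power_iff Field_omega_power)
  moreover have "b \<noteq> a" using fa assms(3) by auto
  moreover from this have "(a, b) \<notin> \<alpha>" using above assms(3) by auto
  ultimately show ?thesis
    using TOTALS by (auto simp: underS_def)
qed

lemma mult_omega_pow_less:
  assumes WO: "Well_order \<alpha>" and b: "b \<in> underS \<alpha> a"
  shows "(\<lambda>i. n * omega_pow b i) \<in> underS (omega_power \<alpha>) (omega_pow a)"
proof (rule omega_power_less_omega_pow[OF WO])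
  have "a \<in> Field \<alpha>" "b \<in> Field \<alpha>" "(b, a) \<in> \<alpha>" "b \<noteq> a" using b by (auto simp: underS_def Field_def)
  then show "a \<in> Field \<alpha>" "n * omega_pow b a = 0" by auto
  show "(\<lambda>i. n * omega_pow b i) \<in> Field (omega_power \<alpha>)"
    using rel_derivative_mult[OF WO omega_pow_Field[OF \<open>b \<in> Field \<alpha>\<close>]] by blast
  show "(i, a) \<in> \<alpha>" if "n * omega_pow b i \<noteq> 0" for i
    using that \<open>(b, a) \<in> \<alpha>\<close> by (cases "i = b") auto
qed

section \<open>Embeddings into spaces of functions with values in a cotype space\<close>

lemma nontrivial_cotype_card_bound:
  fixes \<delta> B :: real
  assumes "nontrivial_cotype TYPE('e::real_normed_vector)" and \<delta>: "\<delta> > 0"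
  shows "\<exists>N::nat. \<forall>(J::'j set) (v::'j \<Rightarrow> 'e). finite J \<longrightarrow>
      (\<forall>s::'j \<Rightarrow> real. (\<forall>j\<in>J. \<bar>s j\<bar> \<le> 1) \<longrightarrow> norm (\<Sum>j\<in>J. s j *\<^sub>R v j) \<le> B) \<longrightarrow>
      (\<forall>j\<in>J. \<delta> \<le> norm (v j)) \<longrightarrow> card J \<le> N"
proof -
  obtain q C :: real where q: "q \<ge> 2" and C: "C > 0"
    and cot: "\<And>(n::nat) (e :: nat \<Rightarrow> 'e). (\<Sum>i=1..n. norm (e i) powr q) powr (1 / q)
            \<le> C * sqrt (integral {0..1} (\<lambda>t. (norm (\<Sum>i=1..n. rademacher i t *\<^sub>R e i))\<^sup>2))"
    using assms(1) unfolding nontrivial_cotype_def by blast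
  define N where "N = nat \<lceil>(C * B) powr q / \<delta> powr q\<rceil>"
  show ?thesis
  proof (intro exI[of _ N] allI impI)
    fix J :: "'j set" and v :: "'j \<Rightarrow> 'e"
    assume fin: "finite J"
      and bd: "\<forall>s::'j \<Rightarrow> real. (\<forall>j\<in>J. \<bar>s j\<bar> \<le> 1) \<longrightarrow> norm (\<Sum>j\<in>J. s j *\<^sub>R v j) \<le> B"
      and large: "\<forall>j\<in>J. \<delta> \<le> norm (v j)"
    define n where "n = card J"
    obtain h where h: "bij_betw h {1..n} J"
      using ex_bij_betw_nat_finite_1[OF fin] n_def by blast
    have B: "0 \<le> B" using bd[rule_format, of "\<lambda>_. 0"] by simp
    have le: "(norm (\<Sum>i=1..n. rademacher i t *\<^sub>R v (h i)))\<^sup>2 \<le> B\<^sup>2" for t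
    proof -
      have "(\<Sum>i=1..n. rademacher i t *\<^sub>R v (h i)) =
          (\<Sum>i=1..n. rademacher (inv_into {1..n} h (h i)) t *\<^sub>R v (h i))"
        using h by (intro sum.cong) (auto simp: bij_betw_inv_into_left)
      also have "\<dots> = (\<Sum>j\<in>J. rademacher (inv_into {1..n} h j) t *\<^sub>R v j)"
        by (rule sum.reindex_bij_betw[OF h])
      finally have "norm (\<Sum>i=1..n. rademacher i t *\<^sub>R v (h i)) \<le> B"
        using bd by (simp add: rademacher_def sgn_if)
      then show ?thesis by (intro power_mono) auto
    qed
    have int: "integral {0..1} (\<lambda>t. (norm (\<Sum>i=1..n. rademacher i t *\<^sub>R v (h i)))\<^sup>2) \<le> B\<^sup>2"
      (is "integral _ ?f \<le> _")
    proof (cases "?f integrable_on {0..1}")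
      case True
      then have "integral {0..1} ?f \<le> integral {0..1::real} (\<lambda>_. B\<^sup>2)"
        using le by (intro integral_le) auto
      then show ?thesis by simp
    next
      case False
      then show ?thesis by (simp add: not_integrable_integral)
    qed
    have "sqrt (integral {0..1} ?f) \<le> B"
      using real_sqrt_le_mono[OF int] B by simp
    then have "(\<Sum>i=1..n. norm (v (h i)) powr q) powr (1 / q) \<le> C * B"
      using order_trans[OF cot[of "\<lambda>i. v (h i)" n]] C by (simp add: mult_left_mono)
    moreover have "real n * \<delta> powr q \<le> (\<Sum>i=1..n. norm (v (h i)) powr q)"
    proof -
      have "(\<Sum>i=1..n. \<delta> powr q) \<le> (\<Sum>i=1..n. norm (v (h i)) powr q)"
        using large h q \<delta> by (intro sum_mono powr_mono2) (auto simp: bij_betw_def)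
      then show ?thesis by simp
    qed
    ultimately have "(real n * \<delta> powr q) powr (1 / q) \<le> C * B"
      using q \<delta> by (meson order_trans powr_mono2 divide_nonneg_nonneg mult_nonneg_nonneg
          of_nat_0_le_iff powr_ge_zero zero_le_one zero_le_numeral)
    then have "((real n * \<delta> powr q) powr (1 / q)) powr q \<le> (C * B) powr q"
      using q by (intro powr_mono2) auto
    then have "real n * \<delta> powr q \<le> (C * B) powr q"
      using q by (simp add: powr_powr)
    then have "real n \<le> (C * B) powr q / \<delta> powr q"
      using \<delta> by (simp add: field_simps)
    then show "card J \<le> N"
      unfolding N_def n_def by linarith
  qed
qed

lemma normal_space_euclidean_compact:
  assumes "compact (UNIV :: 'a::t2_space set)"
  shows "normal_space (euclidean :: 'a topology)"
proof (rule compact_Hausdorff_or_regular_imp_normal_space)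
  show "compact_space (euclidean :: 'a topology)"
    using assms by (simp add: compact_space_def)
  have "Hausdorff_space (euclidean :: 'a topology)"
    unfolding Hausdorff_space_def using hausdorff by (metis disjnt_def open_openin)
  then show "Hausdorff_space (euclidean :: 'a topology) \<or> regular_space (euclidean :: 'a topology)" ..
qed

definition bump :: "'a::topological_space set \<Rightarrow> 'a set \<Rightarrow> ('a \<Rightarrow> real) \<Rightarrow> bool" where
  "bump U A \<phi> \<longleftrightarrow> continuous_on UNIV \<phi> \<and> (\<forall>x. 0 \<le> \<phi> x \<and> \<phi> x \<le> 1) \<and> (\<forall>x. x \<notin> U \<longrightarrow> \<phi> x = 0)
     \<and> (\<exists>V. open V \<and> V \<inter> A \<noteq> {} \<and> (\<forall>x\<in>V. \<phi> x = 1))"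

lemma bump_exists:
  fixes U :: "'a::t2_space set"
  assumes "compact (UNIV :: 'a set)" "open U" "x \<in> U"
  shows "\<exists>\<phi>. bump U {x} \<phi>"
proof -
  have "closedin euclidean (- U)" "closedin euclidean {x}" "disjnt (- U) {x}"
    using assms(2,3) by (auto simp: disjnt_def)
  then obtain g :: "'a \<Rightarrow> real" where g: "continuous_map euclidean euclideanreal g"
    and g0: "g ` (- U) \<subseteq> {0}" and g1: "g ` {x} \<subseteq> {1}"
    using Urysohn_lemma_alt[OF normal_space_euclidean_compact[OF assms(1)]] by metis
  have cg: "continuous_on UNIV g" using g by simp
  define \<phi> where "\<phi> = (\<lambda>z. max 0 (min 1 (2 * g z)))"
  have "open {z. 1/2 < g z}"
    using open_Collect_less[OF continuous_on_const cg] .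
  moreover have "x \<in> {z. 1/2 < g z}" using g1 by simp
  moreover have "\<forall>z\<in>{z. 1/2 < g z}. \<phi> z = 1" by (simp add: \<phi>_def)
  ultimately have "\<exists>V. open V \<and> V \<inter> {x} \<noteq> {} \<and> (\<forall>z\<in>V. \<phi> z = 1)" by blast
  moreover have "continuous_on UNIV \<phi>"
    unfolding \<phi>_def by (intro continuous_intros cg)
  moreover have "\<phi> z = 0" if "z \<notin> U" for z
    using g0 that by (auto simp: \<phi>_def)
  moreover have "0 \<le> \<phi> z \<and> \<phi> z \<le> 1" for z by (simp add: \<phi>_def)
  ultimately show ?thesis unfolding bump_def by blast
qed

lemma separate_finite:
  fixes P :: "'a::t2_space set"
  assumes "finite P"
  shows "\<exists>U. (\<forall>x\<in>P. open (U x) \<and> x \<in> U x) \<and> disjoint_family_on U P"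
  using assms
proof (induction P rule: finite_induct)
  case empty
  then show ?case by (simp add: disjoint_family_on_def)
next
  case (insert z P)
  then obtain U where U: "\<And>x. x \<in> P \<Longrightarrow> open (U x) \<and> x \<in> U x" "disjoint_family_on U P" by auto
  have "\<forall>x\<in>P. \<exists>V W. open V \<and> open W \<and> x \<in> V \<and> z \<in> W \<and> V \<inter> W = {}"
    using hausdorff insert(2) by metis
  then obtain V W where VW: "\<And>x. x \<in> P \<Longrightarrow> open (V x) \<and> open (W x) \<and> x \<in> V x \<and> z \<in> W x \<and> V x \<inter> W x = {}"
    by metis
  define U' where "U' = (\<lambda>x. if x = z then \<Inter>x\<in>P. W x else U x \<inter> V x)"
  have "open (U' x) \<and> x \<in> U' x" if "x \<in> insert z P" for x
    using that U(1) VW insert(1,2) by (auto simp: U'_def intro!: open_INT)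
  moreover have "disjoint_family_on U' (insert z P)"
  proof -
    have "U' x \<inter> U' z = {}" if "x \<in> P" for x
      using that VW[OF that] insert(2) by (auto simp: U'_def)
    moreover have "U' x \<inter> U' y = {}" if "x \<in> P" "y \<in> P" "x \<noteq> y" for x y
      using that U(2) insert(2) unfolding U'_def disjoint_family_on_def by (auto split: if_splits)
    ultimately show ?thesis
      unfolding disjoint_family_on_def by (metis Int_commute insert_iff)
  qed
  ultimately show ?case by blast
qed

locale cotype_embedding =
  fixes F :: "('k::t2_space \<Rightarrow> real) \<Rightarrow> 'l::t2_space \<Rightarrow> 'e::real_normed_vector" and M c :: real
  assumes compact_domain: "compact (UNIV :: 'k set)"
    and compact_codomain: "compact (UNIV :: 'l set)"
    and cotype: "nontrivial_cotype TYPE('e)"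
    and F_add: "\<And>\<phi> \<psi> y. continuous_on UNIV \<phi> \<Longrightarrow> continuous_on UNIV \<psi> \<Longrightarrow>
      F (\<lambda>x. \<phi> x + \<psi> x) y = F \<phi> y + F \<psi> y"
    and F_scale: "\<And>\<phi> t y. continuous_on UNIV \<phi> \<Longrightarrow> F (\<lambda>x. t * \<phi> x) y = t *\<^sub>R F \<phi> y"
    and continuous_F: "\<And>\<phi>. continuous_on UNIV \<phi> \<Longrightarrow> continuous_on UNIV (F \<phi>)"
    and F_bound: "\<And>\<phi> b y. continuous_on UNIV \<phi> \<Longrightarrow> (\<And>x. \<bar>\<phi> x\<bar> \<le> b) \<Longrightarrow> norm (F \<phi> y) \<le> M * b"
    and F_below: "\<And>\<phi> b x. continuous_on UNIV \<phi> \<Longrightarrow> (\<And>y. norm (F \<phi> y) \<le> b) \<Longrightarrow> \<bar>\<phi> x\<bar> \<le> c * b"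
    and M_pos: "0 < M" and c_pos: "0 < c"
begin

lemma F_zero: "F (\<lambda>_. 0) y = 0"
  using F_scale[of "\<lambda>_. 0" 0 y] by simp

lemma F_sum:
  assumes "finite J" "\<And>j. j \<in> J \<Longrightarrow> continuous_on UNIV (\<phi> j)"
  shows "F (\<lambda>x. \<Sum>j\<in>J. s j * \<phi> j x) y = (\<Sum>j\<in>J. s j *\<^sub>R F (\<phi> j) y)"
  using assms
proof (induction J rule: finite_induct)
  case empty
  then show ?case by (simp add: F_zero)
next
  case (insert j J)
  have "F (\<lambda>x. \<Sum>j\<in>insert j J. s j * \<phi> j x) y = F (\<lambda>x. s j * \<phi> j x + (\<Sum>j\<in>J. s j * \<phi> j x)) y"
    using insert(1,2) by simp
  also have "\<dots> = F (\<lambda>x. s j * \<phi> j x) y + F (\<lambda>x. \<Sum>j\<in>J. s j * \<phi> j x) y"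
    using insert(4) by (intro F_add continuous_intros) auto
  finally show ?case
    using insert by (simp add: F_scale)
qed

lemma card_large_images:
  fixes \<delta> :: real and k :: nat
  assumes "\<delta> > 0"
  shows "\<exists>N::nat. \<forall>(J::'j set) (\<phi>::'j \<Rightarrow> 'k \<Rightarrow> real) y. finite J \<longrightarrow>
      (\<forall>j\<in>J. continuous_on UNIV (\<phi> j) \<and> (\<forall>x. \<bar>\<phi> j x\<bar> \<le> 1)) \<longrightarrow>
      (\<forall>x. card {j\<in>J. \<phi> j x \<noteq> 0} \<le> k) \<longrightarrow> card {j\<in>J. \<delta> \<le> norm (F (\<phi> j) y)} \<le> N"
proof -
  obtain N where N: "\<And>(J::'j set) (v::'j \<Rightarrow> 'e). finite J \<Longrightarrow>
      (\<forall>s::'j \<Rightarrow> real. (\<forall>j\<in>J. \<bar>s j\<bar> \<le> 1) \<longrightarrow> norm (\<Sum>j\<in>J. s j *\<^sub>R v j) \<le> M * real k) \<Longrightarrow>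
      (\<forall>j\<in>J. \<delta> \<le> norm (v j)) \<Longrightarrow> card J \<le> N"
    using nontrivial_cotype_card_bound[OF cotype assms, of "M * real k"] by blast
  show ?thesis
  proof (intro exI[of _ N] allI impI)
    fix J :: "'j set" and \<phi> :: "'j \<Rightarrow> 'k \<Rightarrow> real" and y
    assume fin: "finite J"
      and \<phi>: "\<forall>j\<in>J. continuous_on UNIV (\<phi> j) \<and> (\<forall>x. \<bar>\<phi> j x\<bar> \<le> 1)"
      and k: "\<forall>x. card {j\<in>J. \<phi> j x \<noteq> 0} \<le> k"
    let ?J = "{j\<in>J. \<delta> \<le> norm (F (\<phi> j) y)}"
    show "card ?J \<le> N"
    proof (rule N[of _ "\<lambda>j. F (\<phi> j) y"])
      show "finite ?J" using fin by simp
      show "\<forall>j\<in>?J. \<delta> \<le> norm (F (\<phi> j) y)" by simp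
      show "\<forall>s::'j \<Rightarrow> real. (\<forall>j\<in>?J. \<bar>s j\<bar> \<le> 1) \<longrightarrow> norm (\<Sum>j\<in>?J. s j *\<^sub>R F (\<phi> j) y) \<le> M * real k"
      proof (intro allI impI)
        fix s :: "'j \<Rightarrow> real" assume s: "\<forall>j\<in>?J. \<bar>s j\<bar> \<le> 1"
        have "\<bar>\<Sum>j\<in>?J. s j * \<phi> j x\<bar> \<le> real k" for x
        proof -
          have "\<bar>\<Sum>j\<in>?J. s j * \<phi> j x\<bar> = \<bar>\<Sum>j\<in>{j\<in>?J. \<phi> j x \<noteq> 0}. s j * \<phi> j x\<bar>"
            using fin by (intro arg_cong[of _ _ abs] sum.mono_neutral_right) auto
          also have "\<dots> \<le> (\<Sum>j\<in>{j\<in>?J. \<phi> j x \<noteq> 0}. \<bar>s j * \<phi> j x\<bar>)"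
            by (rule sum_abs)
          also have "\<dots> \<le> (\<Sum>j\<in>{j\<in>?J. \<phi> j x \<noteq> 0}. 1)"
            using s \<phi> by (intro sum_mono) (auto simp: abs_mult intro!: mult_le_one)
          also have "\<dots> \<le> real (card {j\<in>J. \<phi> j x \<noteq> 0})"
            using fin by (simp add: card_mono subset_iff)
          also have "\<dots> \<le> real k" using k by simp
          finally show ?thesis .
        qed
        then have "norm (F (\<lambda>x. \<Sum>j\<in>?J. s j * \<phi> j x) y) \<le> M * real k"
          using \<phi> by (intro F_bound continuous_intros) auto
        then show "norm (\<Sum>j\<in>?J. s j *\<^sub>R F (\<phi> j) y) \<le> M * real k"
          using F_sum[of ?J \<phi> s y] fin \<phi> by simp
      qed
    qed
  qed
qed

lemma bump_small_on_finite:
  assumes "finite S" "open U" "U \<inter> derived A \<noteq> {}" "\<epsilon> > 0"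
  shows "\<exists>\<phi>. bump U A \<phi> \<and> (\<forall>y\<in>S. norm (F \<phi> y) < \<epsilon>)"
proof (rule ccontr)
  assume contra: "\<not> ?thesis"
  obtain N where N: "\<And>(J::'k set) \<phi> y. finite J \<Longrightarrow>
      (\<forall>j\<in>J. continuous_on UNIV (\<phi> j) \<and> (\<forall>x. \<bar>\<phi> j x\<bar> \<le> 1)) \<Longrightarrow>
      (\<forall>x. card {j\<in>J. \<phi> j x \<noteq> 0} \<le> 1) \<Longrightarrow> card {j\<in>J. \<epsilon> \<le> norm (F (\<phi> j) y)} \<le> N"
    using card_large_images[OF assms(4), of 1] by blast
  have "infinite (U \<inter> A)"
    using assms(2,3) by (auto simp: derived_def islimpt_eq_acc_point)
  then obtain P where P: "finite P" "card P = Suc (card S * N)" "P \<subseteq> U \<inter> A"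
    using infinite_arbitrarily_large by blast
  obtain V where V: "\<And>x. x \<in> P \<Longrightarrow> open (V x) \<and> x \<in> V x" "disjoint_family_on V P"
    using separate_finite[OF P(1)] by blast
  have "\<forall>x\<in>P. \<exists>\<phi>. bump (U \<inter> V x) {x} \<phi>"
    using V(1) P(3) assms(2) by (intro ballI bump_exists[OF compact_domain]) auto
  then obtain \<phi> where \<phi>: "\<And>x. x \<in> P \<Longrightarrow> bump (U \<inter> V x) {x} (\<phi> x)" by metis
  have "bump U A (\<phi> x)" if "x \<in> P" for x
    using \<phi>[OF that] that P(3) unfolding bump_def by blast
  then have "\<forall>x\<in>P. \<exists>y\<in>S. \<epsilon> \<le> norm (F (\<phi> x) y)"
    using contra by (meson not_le)
  then have "P \<subseteq> (\<Union>y\<in>S. {x\<in>P. \<epsilon> \<le> norm (F (\<phi> x) y)})" by blast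
  then have "card P \<le> card (\<Union>y\<in>S. {x\<in>P. \<epsilon> \<le> norm (F (\<phi> x) y)})"
    using P(1) assms(1) by (intro card_mono) auto
  also have "\<dots> \<le> (\<Sum>y\<in>S. card {x\<in>P. \<epsilon> \<le> norm (F (\<phi> x) y)})"
    by (rule card_UN_le[OF assms(1)])
  also have "\<dots> \<le> (\<Sum>y\<in>S. N)"
  proof (rule sum_mono, rule N[OF P(1)])
    show "\<forall>j\<in>P. continuous_on UNIV (\<phi> j) \<and> (\<forall>x. \<bar>\<phi> j x\<bar> \<le> 1)"
      using \<phi> unfolding bump_def by (simp add: abs_le_iff order_trans[of _ 0])
    show "\<forall>x. card {j\<in>P. \<phi> j x \<noteq> 0} \<le> 1"
    proof
      fix x
      have "j = i" if "j \<in> P" "i \<in> P" "\<phi> j x \<noteq> 0" "\<phi> i x \<noteq> 0" for i j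
      proof -
        have "x \<in> V j" "x \<in> V i" using \<phi> that unfolding bump_def by blast+
        then show ?thesis using V(2) that(1,2) unfolding disjoint_family_on_def by blast
      qed
      then show "card {j\<in>P. \<phi> j x \<noteq> 0} \<le> 1"
        using P(1) by (auto simp: card_le_Suc0_iff_eq)
    qed
  qed
  finally show False using P(2) by simp
qed

lemma nested_bumps:
  fixes \<tau> :: "'k set \<Rightarrow> 'k set" and n :: nat
  assumes step: "\<forall>Z U A. Z \<in> \<Z> \<longrightarrow> open U \<longrightarrow> U \<subseteq> U\<^sub>0 \<longrightarrow> U \<inter> \<tau> A \<noteq> {} \<longrightarrow>
      (\<exists>\<phi>. bump U A \<phi> \<and> (\<forall>y\<in>Z. norm (F \<phi> y) < \<epsilon>) \<and> Z \<union> {y\<in>Y. \<epsilon> \<le> norm (F \<phi> y)} \<in> \<Z>)"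
    and \<epsilon>: "0 \<le> \<epsilon>"
    and "Z \<in> \<Z>" "open U" "U \<subseteq> U\<^sub>0" "U \<inter> (\<tau> ^^ n) A \<noteq> {}"
  shows "\<exists>g. continuous_on UNIV g \<and> (\<forall>x. 0 \<le> g x \<and> g x \<le> real n) \<and> (\<forall>x. x \<notin> U \<longrightarrow> g x = 0) \<and>
      (\<exists>V. open V \<and> V \<inter> A \<noteq> {} \<and> (\<forall>x\<in>V. g x = real n)) \<and>
      (\<forall>y\<in>Y. norm (F g y) \<le> M + real n * \<epsilon>) \<and> (\<forall>y\<in>Z. norm (F g y) \<le> real n * \<epsilon>)"
  using assms(3-)
proof (induction n arbitrary: Z U)
  case 0
  then show ?case
    using M_pos by (intro exI[of _ "\<lambda>_. 0"]) (auto simp: F_zero)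
next
  case (Suc n)
  have "U \<inter> \<tau> ((\<tau> ^^ n) A) \<noteq> {}" using Suc.prems(4) by simp
  then obtain \<phi> where \<phi>: "bump U ((\<tau> ^^ n) A) \<phi>" "\<And>y. y \<in> Z \<Longrightarrow> norm (F \<phi> y) < \<epsilon>"
    and Z': "Z \<union> {y\<in>Y. \<epsilon> \<le> norm (F \<phi> y)} \<in> \<Z>" (is "?Z' \<in> _")
    using step Suc.prems(1-3) by meson
  obtain V where V: "open V" "V \<inter> (\<tau> ^^ n) A \<noteq> {}" "\<And>x. x \<in> V \<Longrightarrow> \<phi> x = 1"
    and c\<phi>: "continuous_on UNIV \<phi>" and \<phi>1: "\<And>x. 0 \<le> \<phi> x \<and> \<phi> x \<le> 1" and \<phi>0: "\<And>x. x \<notin> U \<Longrightarrow> \<phi> x = 0"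
    using \<phi>(1) unfolding bump_def by blast
  have VU: "V \<subseteq> U" using V(3) \<phi>0 by force
  then have VU0: "V \<subseteq> U\<^sub>0" using Suc.prems(3) by blast
  obtain g W where g: "continuous_on UNIV g" "\<forall>x. 0 \<le> g x \<and> g x \<le> real n" "\<forall>x. x \<notin> V \<longrightarrow> g x = 0"
    and W: "open W" "W \<inter> A \<noteq> {}" "\<forall>x\<in>W. g x = real n"
    and gY: "\<forall>y\<in>Y. norm (F g y) \<le> M + real n * \<epsilon>"
    and gZ: "\<forall>y\<in>?Z'. norm (F g y) \<le> real n * \<epsilon>"
    using Suc.IH[OF Z' V(1) VU0 V(2)] by (elim exE conjE) (rule that)
  let ?g = "\<lambda>x. \<phi> x + g x"
  have F: "norm (F ?g y) \<le> norm (F \<phi> y) + norm (F g y)" for y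
    by (simp add: F_add[OF c\<phi> g(1)] norm_triangle_ineq)
  show ?case
  proof (intro exI[of _ ?g] conjI allI impI ballI)
    show "continuous_on UNIV ?g" by (intro continuous_intros c\<phi> g)
    show "0 \<le> ?g x" "?g x \<le> real (Suc n)" for x using \<phi>1[of x] g(2)[rule_format, of x] by simp_all
    show "?g x = 0" if "x \<notin> U" for x
      using that \<phi>0[OF that] g(3)[rule_format, of x] VU by auto
    show "\<exists>V. open V \<and> V \<inter> A \<noteq> {} \<and> (\<forall>x\<in>V. ?g x = real (Suc n))"
    proof (cases "n = 0")
      case True
      then show ?thesis using V g(2) by (intro exI[of _ V]) (simp add: order_antisym)
    next
      case False
      then have "\<phi> x = 1" if "x \<in> W" for x using W(3)[rule_format, OF that] g(3)[rule_format, of x] V(3)[of x] by auto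
      then show ?thesis using W by (intro exI[of _ W]) simp
    qed
    show "norm (F ?g y) \<le> M + real (Suc n) * \<epsilon>" if "y \<in> Y" for y
    proof (cases "\<epsilon> \<le> norm (F \<phi> y)")
      case True
      have "norm (F \<phi> y) \<le> M"
        using F_bound[OF c\<phi>, of 1 y] \<phi>1 by simp
      then show ?thesis
        using F[of y] gZ[rule_format, of y] True that \<epsilon> by (simp add: algebra_simps)
    next
      case False
      then show ?thesis
        using F[of y] gY[rule_format, OF that] by (simp add: algebra_simps)
    qed
    show "norm (F ?g y) \<le> real (Suc n) * \<epsilon>" if "y \<in> Z" for y
      using F[of y] gZ[rule_format, of y] \<phi>(2)[of y] that by (simp add: algebra_simps)
  qed
qed

end

section \<open>Functions with small images\<close>

lemma rel_derivative_compact_empty: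
  fixes S :: "'a::t2_space set"
  assumes WO: "Well_order r" and "compact S" and "rel_derivative r S a = {}" "underS r a \<noteq> {}"
  shows "\<exists>b\<in>underS r a. derived (rel_derivative r S b) = {}"
proof (rule ccontr)
  assume contra: "\<not> ?thesis"
  let ?E = "\<lambda>b. derived (rel_derivative r S b)"
  have ES: "?E b \<subseteq> S" for b
    using derived_subset rel_derivative_subset[OF WO] by (rule subset_trans)
  have clS: "closed S" using assms(2) by (rule compact_imp_closed)
  have "S \<inter> \<Inter> (?E ` underS r a) \<noteq> {}"
  proof (rule compact_imp_fip[OF assms(2)])
    show "closed T" if "T \<in> ?E ` underS r a" for T
      using that closed_derived closed_rel_derivative[OF WO clS] by blast
    fix \<F> assume "finite \<F>" "\<F> \<subseteq> ?E ` underS r a"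
    then obtain G where G: "G \<subseteq> underS r a" "finite G" "\<F> = ?E ` G"
      by (meson finite_subset_image)
    show "S \<inter> \<Inter> \<F> \<noteq> {}"
    proof (cases "G = {}")
      case True
      then show ?thesis using G(3) ES contra assms(4) by auto
    next
      case False
      have "G \<subseteq> Field r" using G(1) by (auto simp: underS_def Field_def)
      then obtain m where m: "m \<in> G" "\<forall>x\<in>G. (x, m) \<in> r"
        using finite_has_greatest[OF WO G(2) False] by blast
      have "?E m \<subseteq> S \<inter> \<Inter> \<F>"
        using ES m(2) unfolding G(3)
        by (intro Int_greatest INT_greatest derived_mono rel_derivative_antimono[OF WO]) auto
      moreover have "?E m \<noteq> {}" using contra m(1) G(1) by blast
      ultimately show ?thesis by blast
    qed
  qed
  then show False
    using assms(3) unfolding rel_derivative_unfold[OF WO, of S a] by simp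
qed

lemma closed_funpow_rel_derivative:
  fixes S :: "'a::t1_space set"
  assumes "Well_order r" "closed S"
  shows "closed (((\<lambda>S. rel_derivative r S a) ^^ n) S)"
  by (induction n) (use assms closed_rel_derivative in auto)

lemma funpow_rel_derivative_mono:
  assumes "Well_order r" "S \<subseteq> S'"
  shows "((\<lambda>S. rel_derivative r S a) ^^ n) S \<subseteq> ((\<lambda>S. rel_derivative r S a) ^^ n) S'"
  by (induction n) (simp_all add: assms rel_derivative_mono)

lemma funpow_rel_derivative_Un:
  fixes A B :: "'a::t1_space set"
  assumes WO: "Well_order r" and cl: "closed A" "closed B"
  shows "((\<lambda>S. rel_derivative r S a) ^^ n) (A \<union> B) \<subseteq>
      ((\<lambda>S. rel_derivative r S a) ^^ n) A \<union> ((\<lambda>S. rel_derivative r S a) ^^ n) B"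
proof (induction n)
  case (Suc n)
  let ?\<tau> = "\<lambda>S. rel_derivative r S a"
  have "?\<tau> ((?\<tau> ^^ n) (A \<union> B)) \<subseteq> ?\<tau> ((?\<tau> ^^ n) A \<union> (?\<tau> ^^ n) B)"
    by (rule rel_derivative_mono[OF WO Suc])
  also have "\<dots> \<subseteq> ?\<tau> ((?\<tau> ^^ n) A) \<union> ?\<tau> ((?\<tau> ^^ n) B)"
    by (intro rel_derivative_Un closed_funpow_rel_derivative WO cl)
  finally show ?case by simp
qed simp

lemma zero_Field_omega_power: "(\<lambda>_. 0) \<in> Field (omega_power \<alpha>)"
  by (simp add: Field_omega_power)

lemma rel_derivative_zero:
  assumes WO: "Well_order \<alpha>"
  shows "rel_derivative (omega_power \<alpha>) S (\<lambda>_. 0) = S"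
proof -
  have "underS (omega_power \<alpha>) (\<lambda>_. 0) = {}"
    by (auto simp: underS_omega_power_iff omega_power_less_def)
  then show ?thesis
    by (simp add: rel_derivative_unfold[OF Well_order_omega_power[OF WO], of S "\<lambda>_. 0"])
qed

lemma zero_underS_omega_pow:
  assumes WO: "Well_order \<alpha>" and "a \<in> Field \<alpha>"
  shows "(\<lambda>_. 0) \<in> underS (omega_power \<alpha>) (omega_pow a)"
  using omega_power_less_omega_pow[OF WO zero_Field_omega_power assms(2)] by simp

lemma rel_derivative_omega_pow_subset:
  assumes WO: "Well_order \<alpha>" and "a \<in> Field \<alpha>"
  shows "rel_derivative (omega_power \<alpha>) S (omega_pow a) \<subseteq> derived S"
  using rel_derivative_subset_derived[OF Well_order_omega_power[OF WO] zero_underS_omega_pow[OF assms], of S]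
  by (simp add: rel_derivative_zero[OF WO])

context cotype_embedding
begin

lemma closed_large_set: "continuous_on UNIV \<phi> \<Longrightarrow> closed S \<Longrightarrow> closed {y\<in>S. \<epsilon> \<le> norm (F \<phi> y)}"
  unfolding Collect_conj_eq Collect_mem_eq
  by (intro closed_Int closed_Collect_le continuous_intros continuous_F)

lemma bump_small_funpow:
  fixes \<alpha> :: "'o rel"
  defines "\<tau> \<equiv> \<lambda>a S. rel_derivative (omega_power \<alpha>) S (omega_pow a)"
  defines "\<sigma> \<equiv> \<lambda>a S. rel_derivative (omega_power \<alpha>) S (omega_pow a)"
  assumes WO: "Well_order \<alpha>" and a: "a \<in> Field \<alpha>"
    and base: "\<And>\<epsilon> S A U. \<epsilon> > 0 \<Longrightarrow> closed S \<Longrightarrow> \<sigma> a S = {} \<Longrightarrow> open U \<Longrightarrow> U \<inter> \<tau> a A \<noteq> {} \<Longrightarrow>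
      \<exists>\<phi>. bump U A \<phi> \<and> (\<forall>y\<in>S. norm (F \<phi> y) < \<epsilon>)"
    and "\<epsilon> > 0"
  shows "\<exists>m. \<forall>S A U. closed S \<longrightarrow> (\<sigma> a ^^ Suc n) S = {} \<longrightarrow> open U \<longrightarrow> U \<inter> (\<tau> a ^^ m) A \<noteq> {} \<longrightarrow>
      (\<exists>\<phi>. bump U A \<phi> \<and> (\<forall>y\<in>S. norm (F \<phi> y) < \<epsilon>))"
  using \<open>\<epsilon> > 0\<close>
proof (induction n arbitrary: \<epsilon>)
  case 0
  show ?case
    using base[OF 0] by (intro exI[of _ 1]) simp
next
  case (Suc n)
  note W = Well_order_omega_power[OF WO]
  have "\<epsilon> / 2 > 0" using Suc.prems by simp
  then obtain m where m: "\<And>S A U. closed S \<Longrightarrow> (\<sigma> a ^^ Suc n) S = {} \<Longrightarrow> open U \<Longrightarrow>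
      U \<inter> (\<tau> a ^^ m) A \<noteq> {} \<Longrightarrow> \<exists>\<phi>. bump U A \<phi> \<and> (\<forall>y\<in>S. norm (F \<phi> y) < \<epsilon> / 2)"
    using Suc.IH by blast
  obtain N :: nat where N: "2 * M / \<epsilon> < N" using reals_Archimedean2 by blast
  have N0: "0 < N" using N M_pos Suc.prems by (metis divide_pos_pos less_trans mult_pos_pos
        of_nat_0_less_iff zero_less_numeral)
  show ?case
  proof (intro exI[of _ "m * N"] allI impI)
    fix S :: "'l set" and A U :: "'k set"
    assume S: "closed S" "(\<sigma> a ^^ Suc (Suc n)) S = {}" and U: "open U" "U \<inter> (\<tau> a ^^ (m * N)) A \<noteq> {}"
    define \<Z> where "\<Z> = {Z. closed Z \<and> \<sigma> a S \<subseteq> Z \<and> (\<sigma> a ^^ Suc n) Z = {}}"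
    have base_in: "\<sigma> a S \<in> \<Z>"
      using S closed_rel_derivative[OF W S(1)]
      unfolding \<Z>_def funpow_Suc_right[of "Suc n"] o_apply by (simp add: \<sigma>_def)
    have step: "\<forall>Z V A. Z \<in> \<Z> \<longrightarrow> open V \<longrightarrow> V \<subseteq> UNIV \<longrightarrow> V \<inter> (\<tau> a ^^ m) A \<noteq> {} \<longrightarrow>
        (\<exists>\<phi>. bump V A \<phi> \<and> (\<forall>y\<in>Z. norm (F \<phi> y) < \<epsilon> / 2) \<and>
          Z \<union> {y\<in>S. \<epsilon> / 2 \<le> norm (F \<phi> y)} \<in> \<Z>)"
    proof (intro allI impI)
      fix Z V A assume Z: "Z \<in> \<Z>" and V: "open V" "V \<inter> (\<tau> a ^^ m) A \<noteq> {}"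
      have clZ: "closed Z" and bZ: "\<sigma> a S \<subseteq> Z" and eZ: "(\<sigma> a ^^ Suc n) Z = {}"
        using Z by (auto simp: \<Z>_def)
      obtain \<phi> where \<phi>: "bump V A \<phi>" "\<forall>y\<in>Z. norm (F \<phi> y) < \<epsilon> / 2"
        using m[OF clZ eZ V] by blast
      let ?L = "{y\<in>S. \<epsilon> / 2 \<le> norm (F \<phi> y)}"
      have clL: "closed ?L" using \<phi>(1) S(1) by (intro closed_large_set) (auto simp: bump_def)
      have "(\<sigma> a ^^ Suc n) ?L \<subseteq> \<sigma> a ?L"
        unfolding funpow_Suc_right o_apply \<sigma>_def by (rule funpow_rel_derivative_subset[OF W])
      moreover have "\<sigma> a ?L \<subseteq> ?L \<inter> \<sigma> a S"
        unfolding \<sigma>_def by (intro Int_greatest rel_derivative_subset rel_derivative_mono W) auto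
      moreover have "?L \<inter> \<sigma> a S = {}" using bZ \<phi>(2) by (auto simp: not_le[symmetric])
      ultimately have eL: "(\<sigma> a ^^ Suc n) ?L = {}" by blast
      have "(\<sigma> a ^^ Suc n) (Z \<union> ?L) \<subseteq> (\<sigma> a ^^ Suc n) Z \<union> (\<sigma> a ^^ Suc n) ?L"
        unfolding \<sigma>_def by (rule funpow_rel_derivative_Un[OF W clZ clL])
      then have "(\<sigma> a ^^ Suc n) (Z \<union> ?L) = {}" using eZ eL by blast
      then have "Z \<union> ?L \<in> \<Z>" using clZ clL bZ by (auto simp: \<Z>_def simp del: funpow.simps)
      then show "\<exists>\<phi>. bump V A \<phi> \<and> (\<forall>y\<in>Z. norm (F \<phi> y) < \<epsilon> / 2) \<and>
          Z \<union> {y\<in>S. \<epsilon> / 2 \<le> norm (F \<phi> y)} \<in> \<Z>"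
        using \<phi> by blast
    qed
    have meets: "U \<inter> ((\<tau> a ^^ m) ^^ N) A \<noteq> {}" using U(2) by (simp add: funpow_mult)
    have half: "0 \<le> \<epsilon> / 2" using Suc.prems by simp
    obtain g V where g: "continuous_on UNIV g" "\<forall>x. 0 \<le> g x \<and> g x \<le> real N" "\<forall>x. x \<notin> U \<longrightarrow> g x = 0"
      and V: "open V" "V \<inter> A \<noteq> {}" "\<forall>x\<in>V. g x = real N"
      and gS: "\<forall>y\<in>S. norm (F g y) \<le> M + real N * (\<epsilon> / 2)"
      using nested_bumps[OF step half base_in U(1) subset_UNIV meets] by (elim exE conjE) (rule that)
    define \<phi> where "\<phi> = (\<lambda>x. (1 / real N) * g x)"
    have "bump U A \<phi>"
      unfolding bump_def \<phi>_def using g V N0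
      by (auto intro!: continuous_intros exI[of _ V] simp: field_simps)
    moreover have "norm (F \<phi> y) < \<epsilon>" if "y \<in> S" for y
    proof -
      have "norm (F \<phi> y) = norm (F g y) / real N"
        unfolding \<phi>_def using F_scale[OF g(1), of "1 / real N" y] by simp
      also have "\<dots> \<le> (M + real N * (\<epsilon> / 2)) / real N"
        using gS that by (intro divide_right_mono) auto
      also have "\<dots> < \<epsilon>"
        using N N0 Suc.prems by (simp add: field_simps)
      finally show ?thesis .
    qed
    ultimately show "\<exists>\<phi>. bump U A \<phi> \<and> (\<forall>y\<in>S. norm (F \<phi> y) < \<epsilon>)" by blast
  qed
qed

lemma bump_small_omega_pow:
  fixes \<alpha> :: "'o rel"
  assumes WO: "Well_order \<alpha>" and "a \<in> Field \<alpha>" "\<epsilon> > 0" "closed S"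
    and "rel_derivative (omega_power \<alpha>) S (omega_pow a) = {}"
    and "open U" "U \<inter> rel_derivative (omega_power \<alpha>) A (omega_pow a) \<noteq> {}"
  shows "\<exists>\<phi>. bump U A \<phi> \<and> (\<forall>y\<in>S. norm (F \<phi> y) < \<epsilon>)"
  using assms(2-)
proof (induction a arbitrary: \<epsilon> S U A rule: Well_order_underS_induct[OF WO])
  case (1 a)
  note W = Well_order_omega_power[OF WO]
  have cS: "compact S"
    using compact_Int_closed[OF compact_codomain 1(4)] by simp
  obtain f where f: "f \<in> underS (omega_power \<alpha>) (omega_pow a)" "derived (rel_derivative (omega_power \<alpha>) S f) = {}"
    using rel_derivative_compact_empty[OF W cS 1(5)] zero_underS_omega_pow[OF WO 1(2)] by blast
  show ?case
  proof (cases "f = (\<lambda>_. 0)")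
    case True
    then have "finite S"
      using f(2) cS by (intro finite_if_derived_empty) (simp_all add: rel_derivative_zero[OF WO])
    moreover have "U \<inter> derived A \<noteq> {}"
      using 1(7) rel_derivative_omega_pow_subset[OF WO 1(2), of A] by blast
    ultimately show ?thesis
      using bump_small_on_finite 1(3,6) by blast
  next
    case False
    have fF: "f \<in> Field (omega_power \<alpha>)" using f(1) by (simp add: underS_omega_power_iff)
    obtain b where b: "b \<in> Field \<alpha>" "f b \<noteq> 0" "\<And>i. f i \<noteq> 0 \<Longrightarrow> (i, b) \<in> \<alpha>"
      using omega_power_leading_exponent[OF WO fF False] by blast
    have ba: "b \<in> underS \<alpha> a"
      by (rule omega_power_below_omega_pow[OF WO f(1) b(2)])
    let ?\<sigma> = "\<lambda>S :: 'l set. rel_derivative (omega_power \<alpha>) S (omega_pow b)"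
    let ?\<tau> = "\<lambda>S :: 'k set. rel_derivative (omega_power \<alpha>) S (omega_pow b)"
    have "(?\<sigma> ^^ Suc (Suc (f b))) S = ?\<sigma> ((?\<sigma> ^^ Suc (f b)) S)" by simp
    also have "\<dots> \<subseteq> ?\<sigma> (rel_derivative (omega_power \<alpha>) S f)"
      by (intro rel_derivative_mono[OF W] funpow_omega_pow_subset[OF WO b(1) fF b(3)]) auto
    also have "\<dots> \<subseteq> {}"
      using rel_derivative_omega_pow_subset[OF WO b(1)] f(2) by blast
    finally have e: "(?\<sigma> ^^ Suc (Suc (f b))) S = {}" by blast
    obtain m where m: "\<And>S A U. closed S \<Longrightarrow> (?\<sigma> ^^ Suc (Suc (f b))) S = {} \<Longrightarrow> open U \<Longrightarrow>
      U \<inter> (?\<tau> ^^ m) A \<noteq> {} \<Longrightarrow> (\<exists>\<phi>. bump U A \<phi> \<and> (\<forall>y\<in>S. norm (F \<phi> y) < \<epsilon>))"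
      using bump_small_funpow[OF WO b(1) 1(1)[OF ba b(1)] 1(3), of "Suc (f b)"] by blast
    have "rel_derivative (omega_power \<alpha>) A (omega_pow a)
        \<subseteq> rel_derivative (omega_power \<alpha>) A (\<lambda>i. m * omega_pow b i)"
      using rel_derivative_subset_derived[OF W mult_omega_pow_less[OF WO ba]] derived_subset
      by (rule subset_trans)
    also have "\<dots> \<subseteq> (?\<tau> ^^ m) A"
      using rel_derivative_mult[OF WO omega_pow_Field[OF b(1)]] by blast
    finally show ?thesis
      using m[OF 1(4) e 1(6)] 1(7) by blast
  qed
qed

lemma exists_large_image:
  fixes \<alpha> :: "'o rel"
  assumes WO: "Well_order \<alpha>" and fF: "f \<in> Field (omega_power \<alpha>)"
  shows "\<exists>g\<in>Field (omega_power \<alpha>). \<forall>U. open U \<longrightarrow> U \<inter> rel_derivative (omega_power \<alpha>) UNIV g \<noteq> {} \<longrightarrow>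
      (\<exists>\<phi> y. continuous_on UNIV \<phi> \<and> (\<forall>x. 0 \<le> \<phi> x \<and> \<phi> x \<le> 1) \<and> (\<forall>x. x \<notin> U \<longrightarrow> \<phi> x = 0) \<and>
         y \<in> rel_derivative (omega_power \<alpha>) UNIV f \<and> 1 / (2 * c) \<le> norm (F \<phi> y))"
proof (cases "f = (\<lambda>_. 0)")
  case True
  show ?thesis
  proof (intro bexI[of _ "\<lambda>_. 0"] allI impI zero_Field_omega_power)
    fix U :: "'k set" assume U: "open U" "U \<inter> rel_derivative (omega_power \<alpha>) UNIV (\<lambda>_. 0) \<noteq> {}"
    then obtain x where "x \<in> U" by blast
    then obtain \<phi> where \<phi>: "bump U {x} \<phi>"
      using bump_exists[OF compact_domain U(1)] by blast
    have "\<exists>y. 1 / (2 * c) \<le> norm (F \<phi> y)"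
    proof (rule ccontr)
      assume "\<nexists>y. 1 / (2 * c) \<le> norm (F \<phi> y)"
      then have "\<bar>\<phi> x\<bar> \<le> c * (1 / (2 * c))"
        using \<phi> by (intro F_below) (auto simp: bump_def not_le less_imp_le)
      moreover have "\<phi> x = 1" using \<phi> by (auto simp: bump_def)
      ultimately show False using c_pos by simp
    qed
    then show "\<exists>\<phi> y. continuous_on UNIV \<phi> \<and> (\<forall>x. 0 \<le> \<phi> x \<and> \<phi> x \<le> 1) \<and> (\<forall>x. x \<notin> U \<longrightarrow> \<phi> x = 0) \<and>
         y \<in> rel_derivative (omega_power \<alpha>) UNIV f \<and> 1 / (2 * c) \<le> norm (F \<phi> y)"
      using \<phi> True rel_derivative_zero[OF WO, of "UNIV :: 'l set"] unfolding bump_def by auto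
  qed
next
  case False
  note W = Well_order_omega_power[OF WO]
  obtain a where a: "a \<in> Field \<alpha>" "f a \<noteq> 0" "\<And>i. f i \<noteq> 0 \<Longrightarrow> (i, a) \<in> \<alpha>"
    using omega_power_leading_exponent[OF WO fF False] by blast
  let ?\<sigma> = "\<lambda>S :: 'l set. rel_derivative (omega_power \<alpha>) S (omega_pow a)"
  let ?\<tau> = "\<lambda>S :: 'k set. rel_derivative (omega_power \<alpha>) S (omega_pow a)"
  define n where "n = f a"
  define \<epsilon> where "\<epsilon> = 1 / (2 * c)"
  have \<epsilon>: "\<epsilon> > 0" using c_pos by (simp add: \<epsilon>_def)
  obtain m where m: "\<And>S A U. closed S \<Longrightarrow> (?\<sigma> ^^ Suc n) S = {} \<Longrightarrow> open U \<Longrightarrow>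
      U \<inter> (?\<tau> ^^ m) A \<noteq> {} \<Longrightarrow> (\<exists>\<phi>. bump U A \<phi> \<and> (\<forall>y\<in>S. norm (F \<phi> y) < \<epsilon>))"
    using bump_small_funpow[OF WO a(1) bump_small_omega_pow[OF WO a(1)] \<epsilon>, of n] by blast
  obtain N :: nat where N: "2 * (c * M) < N" using reals_Archimedean2 by blast
  define g where "g = (\<lambda>i. (m * N) * omega_pow a i)"
  have g: "g \<in> Field (omega_power \<alpha>)" "rel_derivative (omega_power \<alpha>) UNIV g \<subseteq> (?\<tau> ^^ (m * N)) UNIV"
    unfolding g_def using rel_derivative_mult[OF WO omega_pow_Field[OF a(1)]] by blast+
  have sub: "(?\<sigma> ^^ Suc n) UNIV \<subseteq> rel_derivative (omega_power \<alpha>) UNIV f"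
    by (rule funpow_omega_pow_subset[OF WO a(1) fF a(3)]) (auto simp: n_def)
  show ?thesis
  proof (intro bexI[of _ g] allI impI g(1), rule ccontr)
    fix U :: "'k set" assume U: "open U" "U \<inter> rel_derivative (omega_power \<alpha>) UNIV g \<noteq> {}"
    assume contra: "\<nexists>\<phi> y. continuous_on UNIV \<phi> \<and> (\<forall>x. 0 \<le> \<phi> x \<and> \<phi> x \<le> 1) \<and> (\<forall>x. x \<notin> U \<longrightarrow> \<phi> x = 0) \<and>
         y \<in> rel_derivative (omega_power \<alpha>) UNIV f \<and> 1 / (2 * c) \<le> norm (F \<phi> y)"
    define \<Z> where "\<Z> = {Z. closed Z \<and> (?\<sigma> ^^ Suc n) Z = {}}"
    have empty_in: "{} \<in> \<Z>"
      using funpow_rel_derivative_subset[OF W, where S = "{}" and a = "omega_pow a" and n = "Suc n"] by (simp add: \<Z>_def)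
    have step: "\<forall>Z V A. Z \<in> \<Z> \<longrightarrow> open V \<longrightarrow> V \<subseteq> U \<longrightarrow> V \<inter> (?\<tau> ^^ m) A \<noteq> {} \<longrightarrow>
        (\<exists>\<phi>. bump V A \<phi> \<and> (\<forall>y\<in>Z. norm (F \<phi> y) < \<epsilon>) \<and>
          Z \<union> {y\<in>UNIV. \<epsilon> \<le> norm (F \<phi> y)} \<in> \<Z>)"
    proof (intro allI impI)
      fix Z V A assume Z: "Z \<in> \<Z>" and V: "open V" "V \<subseteq> U" "V \<inter> (?\<tau> ^^ m) A \<noteq> {}"
      have clZ: "closed Z" and eZ: "(?\<sigma> ^^ Suc n) Z = {}" using Z by (auto simp: \<Z>_def)
      obtain \<phi> where \<phi>: "bump V A \<phi>" "\<forall>y\<in>Z. norm (F \<phi> y) < \<epsilon>"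
        using m[OF clZ eZ V(1,3)] by blast
      let ?L = "{y\<in>UNIV. \<epsilon> \<le> norm (F \<phi> y)}"
      have clL: "closed ?L" using \<phi>(1) by (intro closed_large_set) (auto simp: bump_def)
      have "?L \<inter> rel_derivative (omega_power \<alpha>) UNIV f = {}"
        using contra \<phi>(1) V(2) unfolding bump_def \<epsilon>_def by blast
      moreover have "(?\<sigma> ^^ Suc n) ?L \<subseteq> ?L" by (rule funpow_rel_derivative_subset[OF W])
      moreover have "(?\<sigma> ^^ Suc n) ?L \<subseteq> (?\<sigma> ^^ Suc n) UNIV"
        by (rule funpow_rel_derivative_mono[OF W]) simp
      ultimately have eL: "(?\<sigma> ^^ Suc n) ?L = {}" using sub by blast
      have "(?\<sigma> ^^ Suc n) (Z \<union> ?L) \<subseteq> (?\<sigma> ^^ Suc n) Z \<union> (?\<sigma> ^^ Suc n) ?L"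
        by (rule funpow_rel_derivative_Un[OF W clZ clL])
      then have "(?\<sigma> ^^ Suc n) (Z \<union> ?L) = {}" using eZ eL by blast
      then have "Z \<union> ?L \<in> \<Z>" unfolding \<Z>_def using closed_Un[OF clZ clL] by blast
      then show "\<exists>\<phi>. bump V A \<phi> \<and> (\<forall>y\<in>Z. norm (F \<phi> y) < \<epsilon>) \<and>
          Z \<union> {y\<in>UNIV. \<epsilon> \<le> norm (F \<phi> y)} \<in> \<Z>"
        using \<phi> by blast
    qed
    have meets: "U \<inter> ((?\<tau> ^^ m) ^^ N) UNIV \<noteq> {}" using U(2) g(2) by (auto simp: funpow_mult)
    obtain h V where h: "continuous_on UNIV h"
      and V: "V \<inter> UNIV \<noteq> {}" "\<forall>x\<in>V. h x = real N"
      and hS: "\<forall>y\<in>UNIV. norm (F h y) \<le> M + real N * \<epsilon>"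
      using nested_bumps[OF step less_imp_le[OF \<epsilon>] empty_in U(1) subset_refl meets]
      by (elim exE conjE) (rule that)
    obtain x where "h x = real N" using V by blast
    then have "real N \<le> c * (M + real N * \<epsilon>)"
      using F_below[OF h, of "M + real N * \<epsilon>" x] hS by simp
    also have "\<dots> = c * M + real N / 2" using c_pos by (simp add: \<epsilon>_def field_simps)
    finally show False using N by simp
  qed
qed

end

section \<open>Point-bounded families and the perfect kernel\<close>

lemma finite_card_of_ordLeq_infinite:
  assumes "finite A" "infinite B"
  shows "|A| \<le>o |B|"
proof -
  obtain C where "C \<subseteq> B" "finite C" "card C = card A"
    using infinite_arbitrarily_large[OF assms(2)] by metis
  then obtain f where "bij_betw f A C"
    using finite_same_card_bij[OF assms(1)] by metis
  then have "inj_on f A" "f ` A \<subseteq> B"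
    using \<open>C \<subseteq> B\<close> by (auto simp: bij_betw_def)
  then show ?thesis using card_of_ordLeqI by blast
qed

lemma card_of_ordLeq_finite_fibres:
  assumes "infinite A" "A \<subseteq> (\<Union>b\<in>B. G b)" "\<And>b. b \<in> B \<Longrightarrow> finite (G b)"
  shows "|A| \<le>o |B|"
proof -
  have "infinite B"
    using assms finite_subset finite_UN_I by metis
  then have "|\<Union>b\<in>B. G b| \<le>o |B|"
    using assms(3) by (intro card_of_UNION_ordLeq_infinite) (auto intro: finite_card_of_ordLeq_infinite ordLeq_refl)
  then show ?thesis
    using card_of_mono1[OF assms(2)] ordLeq_transitive by blast
qed

text \<open>\<open>is_card_sup\<close> only speaks about upper bounds over the same type; this is its transfer to
  bounds over any type.\<close>

lemma card_sup_least:
  fixes C :: "'a rel set" and \<kappa> :: "'b rel"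
  assumes "\<And>c. c \<in> C \<Longrightarrow> Card_order c" and \<kappa>: "Card_order \<kappa>" and "\<And>c. c \<in> C \<Longrightarrow> c \<le>o \<kappa>"
  shows "card_sup C \<le>o \<kappa>"
proof (rule ccontr)
  assume contra: "\<not> card_sup C \<le>o \<kappa>"
  have sup: "is_card_sup C (card_sup C)"
    using assms(1) by (rule is_card_sup_card_sup)
  then have co: "Card_order (card_sup C)" by (simp add: is_card_sup_def)
  have less: "\<kappa> <o card_sup C"
    using contra co \<kappa> by (simp add: not_ordLeq_iff_ordLess card_order_on_well_order_on)
  have "|Field \<kappa>| \<le>o card_sup C"
    using card_of_Field_ordIso[OF \<kappa>] less ordIso_ordLess_trans ordLess_imp_ordLeq by blast
  also have "card_sup C \<le>o |Field (card_sup C)|"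
    using card_of_Field_ordIso[OF co] ordIso_symmetric ordIso_imp_ordLeq by blast
  finally have "\<exists>f. inj_on f (Field \<kappa>) \<and> f ` Field \<kappa> \<subseteq> Field (card_sup C)"
    by (simp only: card_of_ordLeq)
  then obtain f :: "'b \<Rightarrow> 'a" where f: "inj_on f (Field \<kappa>)" by blast
  then have "|Field \<kappa>| =o |f ` Field \<kappa>|"
    by (intro card_of_ordIsoI[of f]) (rule inj_on_imp_bij_betw)
  then have iso: "\<kappa> =o |f ` Field \<kappa>|"
    using card_of_Field_ordIso[OF \<kappa>] ordIso_symmetric ordIso_transitive by metis
  then have "\<forall>c\<in>C. c \<le>o |f ` Field \<kappa>|"
    using assms(3) ordLeq_ordIso_trans by blast
  then have "card_sup C \<le>o |f ` Field \<kappa>|"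
    using sup card_of_Card_order unfolding is_card_sup_def by blast
  then have "card_sup C \<le>o \<kappa>"
    using iso ordIso_symmetric ordLeq_ordIso_trans by blast
  then show False using contra by blast
qed

definition pb_family :: "'a::topological_space set \<Rightarrow> 'a set set \<Rightarrow> bool" where
  "pb_family A \<U> \<longleftrightarrow> (\<forall>U\<in>\<U>. open U \<and> U \<noteq> {}) \<and> point_bounded \<U> \<and> (\<forall>U\<in>\<U>. A \<inter> U \<noteq> {})"

lemma is_card_sup_c_pb: "is_card_sup {|\<U>| |\<U>. pb_family A \<U>} (c_pb A)"
  unfolding c_pb_def pb_family_def
  by (rule is_card_sup_card_sup) (auto simp: card_of_Card_order)

lemma Card_order_c_pb: "Card_order (c_pb A)"
  using is_card_sup_c_pb[of A] by (simp add: is_card_sup_def)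

lemma c_pb_upper: "pb_family A \<U> \<Longrightarrow> |\<U>| \<le>o c_pb A"
  using is_card_sup_c_pb[of A] unfolding is_card_sup_def by blast

lemma c_pb_least:
  assumes "Card_order \<kappa>" "\<And>\<U>. pb_family A \<U> \<Longrightarrow> |\<U>| \<le>o \<kappa>"
  shows "c_pb A \<le>o \<kappa>"
  using assms unfolding c_pb_def pb_family_def
  by (intro card_sup_least) (auto simp: card_of_Card_order)

lemma pb_family_mono:
  assumes "A \<subseteq> B" "pb_family A \<U>"
  shows "pb_family B \<U>"
proof -
  have "B \<inter> U \<noteq> {}" if "U \<in> \<U>" for U
    using assms that unfolding pb_family_def by blast
  then show ?thesis using assms(2) by (simp add: pb_family_def)
qed

lemma c_pb_mono: "A \<subseteq> B \<Longrightarrow> c_pb A \<le>o c_pb B"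
  using c_pb_least[OF Card_order_c_pb c_pb_upper] pb_family_mono by blast

lemma finite_ordLeq_c_pb:
  fixes A :: "'a::t1_space set"
  assumes "infinite (UNIV :: 'a set)" "A \<noteq> {}" "finite X"
  shows "|X| \<le>o c_pb A"
proof -
  obtain x where x: "x \<in> A" using assms(2) by blast
  have "infinite (UNIV - {x})" using assms(1) by simp
  then obtain Y where Y: "finite Y" "card Y = card X" "Y \<subseteq> UNIV - {x}"
    using infinite_arbitrarily_large by metis
  let ?\<V> = "(\<lambda>y. - {y}) ` Y"
  have "inj_on (\<lambda>y. - {y}) Y" by (auto simp: inj_on_def)
  then have "card ?\<V> = card X" using Y(2) card_image by metis
  then have "|X| =o |?\<V>|"
    using finite_same_card_bij[OF assms(3)] Y(1) card_of_ordIsoI by (metis finite_imageI)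
  moreover have "pb_family A ?\<V>"
    unfolding pb_family_def point_bounded_def
  proof (intro conjI ballI exI[of _ "card ?\<V>"] allI)
    fix U assume "U \<in> ?\<V>"
    then have "open U" "x \<in> U" using Y(3) by auto
    then show "open U" "U \<noteq> {}" "A \<inter> U \<noteq> {}" using x by blast+
  next
    fix z show "finite {U \<in> ?\<V>. z \<in> U}" using Y(1) by simp
    show "card {U \<in> ?\<V>. z \<in> U} \<le> card ?\<V>" using Y(1) by (intro card_mono) auto
  qed
  ultimately show ?thesis
    using c_pb_upper ordIso_ordLeq_trans by blast
qed

lemma (in cotype_embedding) c_pb_ordLeq:
  fixes A :: "'k set" and B :: "'l set"
  assumes inf: "infinite (UNIV :: 'l set)" and \<delta>: "\<delta> > 0"
    and large: "\<And>U. open U \<Longrightarrow> U \<inter> A \<noteq> {} \<Longrightarrow>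
      \<exists>\<phi> y. continuous_on UNIV \<phi> \<and> (\<forall>x. 0 \<le> \<phi> x \<and> \<phi> x \<le> 1) \<and> (\<forall>x. x \<notin> U \<longrightarrow> \<phi> x = 0) \<and>
        y \<in> B \<and> \<delta> \<le> norm (F \<phi> y)"
  shows "c_pb A \<le>o c_pb B"
proof (rule c_pb_least[OF Card_order_c_pb])
  fix \<U> assume \<U>: "pb_family A \<U>"
  then obtain k where k: "\<And>x. finite {U\<in>\<U>. x \<in> U}" "\<And>x. card {U\<in>\<U>. x \<in> U} \<le> k"
    unfolding pb_family_def point_bounded_def by blast
  have "\<forall>U\<in>\<U>. \<exists>\<phi> y. continuous_on UNIV \<phi> \<and> (\<forall>x. 0 \<le> \<phi> x \<and> \<phi> x \<le> 1) \<and>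
      (\<forall>x. x \<notin> U \<longrightarrow> \<phi> x = 0) \<and> y \<in> B \<and> \<delta> \<le> norm (F \<phi> y)"
    using \<U> large unfolding pb_family_def by (metis Int_commute)
  then obtain \<phi> y where c\<phi>: "\<And>U. U \<in> \<U> \<Longrightarrow> continuous_on UNIV (\<phi> U)"
    and \<phi>1: "\<And>U x. U \<in> \<U> \<Longrightarrow> 0 \<le> \<phi> U x \<and> \<phi> U x \<le> 1"
    and \<phi>0: "\<And>U x. U \<in> \<U> \<Longrightarrow> x \<notin> U \<Longrightarrow> \<phi> U x = 0"
    and y: "\<And>U. U \<in> \<U> \<Longrightarrow> y U \<in> B \<and> \<delta> \<le> norm (F (\<phi> U) (y U))"
    by metis
  show "|\<U>| \<le>o c_pb B"
  proof (cases "finite \<U>")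
    case True
    show ?thesis
    proof (cases "\<U> = {}")
      case True
      then show ?thesis by (simp add: Card_order_c_pb card_of_empty1 card_order_on_well_order_on)
    next
      case False
      then have "B \<noteq> {}" using y by blast
      then show ?thesis using finite_ordLeq_c_pb[OF inf] True by blast
    qed
  next
    case infU: False
    have "\<delta> / 2 > 0" using \<delta> by simp
    then obtain N where N: "\<And>(J::'k set set) (\<phi>::'k set \<Rightarrow> 'k \<Rightarrow> real) y. finite J \<Longrightarrow>
        (\<forall>j\<in>J. continuous_on UNIV (\<phi> j) \<and> (\<forall>x. \<bar>\<phi> j x\<bar> \<le> 1)) \<Longrightarrow>
        (\<forall>x. card {j\<in>J. \<phi> j x \<noteq> 0} \<le> k) \<Longrightarrow> card {j\<in>J. \<delta> / 2 \<le> norm (F (\<phi> j) y)} \<le> N"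
      using card_large_images[of "\<delta> / 2" k] by blast
    define V where "V = (\<lambda>U. {z. \<delta> / 2 < norm (F (\<phi> U) z)})"
    let ?H = "\<lambda>z. {U\<in>\<U>. z \<in> V U}"
    have bound: "card J \<le> N" if J: "finite J" "J \<subseteq> ?H z" for J z
    proof -
      have "card {U\<in>J. \<phi> U x \<noteq> 0} \<le> k" for x
      proof -
        have "{U\<in>J. \<phi> U x \<noteq> 0} \<subseteq> {U\<in>\<U>. x \<in> U}" using J(2) \<phi>0 by blast
        then show ?thesis using card_mono[OF k(1)] k(2) order_trans by blast
      qed
      moreover have "\<forall>U\<in>J. continuous_on UNIV (\<phi> U) \<and> (\<forall>x. \<bar>\<phi> U x\<bar> \<le> 1)"
        using J(2) c\<phi> \<phi>1 by auto
      ultimately have "card {U\<in>J. \<delta> / 2 \<le> norm (F (\<phi> U) z)} \<le> N"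
        using N[OF J(1)] by blast
      moreover have "{U\<in>J. \<delta> / 2 \<le> norm (F (\<phi> U) z)} = J"
        using J(2) by (auto simp: V_def)
      ultimately show ?thesis by simp
    qed
    have finH: "finite (?H z)" for z
    proof (rule ccontr)
      assume "infinite (?H z)"
      then obtain J where "finite J" "card J = Suc N" "J \<subseteq> ?H z"
        using infinite_arbitrarily_large[of "?H z" "Suc N"] by blast
      then show False using bound[of J z] by simp
    qed
    have yV: "y U \<in> V U" if "U \<in> \<U>" for U
    proof -
      have "\<delta> \<le> norm (F (\<phi> U) (y U))" using y[OF that] by simp
      then show ?thesis using \<delta> by (simp add: V_def)
    qed
    have "pb_family B (V ` \<U>)"
      unfolding pb_family_def point_bounded_def
    proof (intro conjI ballI exI[of _ N] allI)
      fix W assume "W \<in> V ` \<U>"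
      then obtain U where U: "U \<in> \<U>" "W = V U" by blast
      show "open W"
        unfolding U(2) V_def using c\<phi>[OF U(1)]
        by (intro open_Collect_less continuous_intros continuous_F)
      show "W \<noteq> {}" "B \<inter> W \<noteq> {}" using yV[OF U(1)] y[OF U(1)] U(2) by blast+
    next
      fix z
      have eq: "{W \<in> V ` \<U>. z \<in> W} = V ` ?H z" by blast
      show "finite {W \<in> V ` \<U>. z \<in> W}" unfolding eq using finH by simp
      show "card {W \<in> V ` \<U>. z \<in> W} \<le> N"
        unfolding eq using card_image_le[OF finH] bound[OF finH subset_refl] order_trans by blast
    qed
    moreover have "|\<U>| \<le>o |V ` \<U>|"
    proof (rule card_of_ordLeq_finite_fibres[OF infU, where G = "\<lambda>W. {U\<in>\<U>. V U = W}"])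
      show "finite {U\<in>\<U>. V U = W}" if "W \<in> V ` \<U>" for W
      proof -
        obtain U where U: "U \<in> \<U>" "W = V U" using \<open>W \<in> V ` \<U>\<close> by blast
        have "{U\<in>\<U>. V U = W} \<subseteq> ?H (y U)" using yV[OF U(1)] U(2) by blast
        then show ?thesis using finH finite_subset by blast
      qed
    qed blast
    ultimately show ?thesis
      using c_pb_upper ordLeq_transitive by blast
  qed
qed

lemma (in cotype_embedding) c_pb_rel_derivative_ordLeq:
  assumes "infinite (UNIV :: 'l set)" "Well_order \<alpha>" "f \<in> Field (omega_power \<alpha>)"
  shows "\<exists>g\<in>Field (omega_power \<alpha>).
      c_pb (cb_derivative (omega_power \<alpha>) g :: 'k set) \<le>o c_pb (cb_derivative (omega_power \<alpha>) f :: 'l set)"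
proof -
  obtain g where g: "g \<in> Field (omega_power \<alpha>)"
    "\<forall>U. open U \<longrightarrow> U \<inter> rel_derivative (omega_power \<alpha>) (UNIV :: 'k set) g \<noteq> {} \<longrightarrow>
      (\<exists>\<phi> y. continuous_on UNIV \<phi> \<and> (\<forall>x. 0 \<le> \<phi> x \<and> \<phi> x \<le> 1) \<and> (\<forall>x. x \<notin> U \<longrightarrow> \<phi> x = 0) \<and>
         y \<in> rel_derivative (omega_power \<alpha>) (UNIV :: 'l set) f \<and> 1 / (2 * c) \<le> norm (F \<phi> y))"
    using exists_large_image[OF assms(2,3)] by blast
  have "1 / (2 * c) > 0" using c_pos by simp
  then have "c_pb (rel_derivative (omega_power \<alpha>) (UNIV :: 'k set) g)
      \<le>o c_pb (rel_derivative (omega_power \<alpha>) (UNIV :: 'l set) f)"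
    using g(2) by (intro c_pb_ordLeq[OF assms(1)]) blast+
  then show ?thesis
    using g(1) cb_derivative_eq_rel_derivative[OF Well_order_omega_power[OF assms(2)]] by metis
qed

lemma card_min_ordLeq:
  assumes "C \<noteq> {}" "C' \<noteq> {}" "\<And>c. c \<in> C \<Longrightarrow> Card_order c" "\<And>c. c \<in> C' \<Longrightarrow> Card_order c"
    and "\<And>c'. c' \<in> C' \<Longrightarrow> \<exists>c\<in>C. c \<le>o c'"
  shows "card_min C \<le>o card_min C'"
proof -
  have "card_min C' \<in> C'" using card_min_least(1) assms by metis
  then obtain c where "c \<in> C" "c \<le>o card_min C'" using assms(5) by blast
  moreover have "card_min C \<le>o c" using card_min_least(2) assms(1,3) \<open>c \<in> C\<close> by metis
  ultimately show ?thesis using ordLeq_transitive by blast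
qed

lemma c_pb_UNIV_eq_cellularity:
  assumes "infinite (UNIV :: 'a::t2_space set)"
  shows "c_pb (UNIV :: 'a::t2_space set) =o cellularity TYPE('a::t2_space)"
proof -
  let ?C = "{|\<U>| |\<U>::'a set set. (\<forall>U\<in>\<U>. open U \<and> U \<noteq> {}) \<and> disjoint \<U>}"
  have sup: "is_card_sup ?C (cellularity TYPE('a))"
    unfolding cellularity_def by (rule is_card_sup_card_sup) (auto simp: card_of_Card_order)
  then have co: "Card_order (cellularity TYPE('a))" by (simp add: is_card_sup_def)
  have upper: "|\<U>| \<le>o cellularity TYPE('a)"
    if "\<And>U. U \<in> \<U> \<Longrightarrow> open U \<and> U \<noteq> {}" "disjoint \<U>" for \<U> :: "'a set set"
    using sup that unfolding is_card_sup_def by blast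
  have "cellularity TYPE('a) \<le>o c_pb (UNIV :: 'a set)"
    unfolding cellularity_def
  proof (rule card_sup_least[OF _ Card_order_c_pb])
    fix c assume "c \<in> ?C"
    then obtain \<U> :: "'a set set" where \<U>: "c = |\<U>|" "\<forall>U\<in>\<U>. open U \<and> U \<noteq> {}" "disjoint \<U>" by blast
    have "finite {U\<in>\<U>. x \<in> U} \<and> card {U\<in>\<U>. x \<in> U} \<le> 1" for x
    proof (cases "\<exists>U\<in>\<U>. x \<in> U")
      case True
      then obtain U where U: "U \<in> \<U>" "x \<in> U" by blast
      have "V = U" if "V \<in> \<U>" "x \<in> V" for V
        using \<U>(3) U that unfolding disjoint_def by (metis disjoint_iff)
      then have "{U\<in>\<U>. x \<in> U} = {U}" using U by blast
      then show ?thesis by simp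
    next
      case False
      then have "{U\<in>\<U>. x \<in> U} = {}" by blast
      then show ?thesis by (simp only:) simp
    qed
    then have "pb_family UNIV \<U>"
      using \<U>(2) unfolding pb_family_def point_bounded_def by auto
    then show "c \<le>o c_pb (UNIV :: 'a set)" unfolding \<U>(1) by (rule c_pb_upper)
  qed (auto simp: card_of_Card_order)
  moreover have "c_pb (UNIV :: 'a set) \<le>o cellularity TYPE('a)"
  proof (rule c_pb_least[OF co])
    fix \<U> :: "'a set set" assume \<U>: "pb_family UNIV \<U>"
    show "|\<U>| \<le>o cellularity TYPE('a)"
    proof (cases "finite \<U>")
      case True
      obtain P :: "'a set" where P: "finite P" "card P = card \<U>"
        using infinite_arbitrarily_large[OF assms] by metis
      obtain W where W: "\<And>x. x \<in> P \<Longrightarrow> open (W x) \<and> x \<in> W x" "disjoint_family_on W P"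
        using separate_finite[OF P(1)] by blast
      have "inj_on W P"
        using W unfolding inj_on_def disjoint_family_on_def by blast
      then have "card (W ` P) = card \<U>" using P(2) card_image by metis
      then have "|\<U>| =o |W ` P|"
        using finite_same_card_bij[OF True] P(1) card_of_ordIsoI by (metis finite_imageI)
      moreover have "|W ` P| \<le>o cellularity TYPE('a)"
      proof (rule upper)
        show "open V \<and> V \<noteq> {}" if "V \<in> W ` P" for V using that W(1) by blast
        show "disjoint (W ` P)"
          unfolding disjoint_def using W(2) unfolding disjoint_family_on_def by fast
      qed
      ultimately show ?thesis using ordIso_ordLeq_trans by blast
    next
      case False
      let ?H = "\<lambda>x. {U\<in>\<U>. x \<in> U}"
      obtain k where k: "\<And>x. finite (?H x)" "\<And>x. card (?H x) \<le> k"
        using \<U> unfolding pb_family_def point_bounded_def by blast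
      define X where "X = {x. ?H x \<noteq> {} \<and> (\<forall>z. ?H x \<subseteq> ?H z \<longrightarrow> ?H z = ?H x)}"
      let ?\<V> = "(\<lambda>x. \<Inter>(?H x)) ` X"
      have maximal: "?H z = ?H x" if "x \<in> X" "z \<in> \<Inter>(?H x)" for x z
      proof -
        have "?H x \<subseteq> ?H z" using that(2) by blast
        then show ?thesis using that(1) unfolding X_def by blast
      qed
      have "|?\<V>| \<le>o cellularity TYPE('a)"
      proof (rule upper)
        fix W assume "W \<in> ?\<V>"
        then obtain x where x: "W = \<Inter>(?H x)" by blast
        have "open W"
          unfolding x using \<U> k(1) by (intro open_Inter) (auto simp: pb_family_def)
        moreover have "x \<in> W" using x by blast
        ultimately show "open W \<and> W \<noteq> {}" by blast
      next
        show "disjoint ?\<V>"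
          unfolding disjoint_def
        proof (intro ballI impI, rule ccontr)
          fix W W' assume "W \<in> ?\<V>" "W' \<in> ?\<V>" and ne: "W \<noteq> W'" "W \<inter> W' \<noteq> {}"
          then obtain x x' z where "x \<in> X" "W = \<Inter>(?H x)" "x' \<in> X" "W' = \<Inter>(?H x')"
            "z \<in> \<Inter>(?H x)" "z \<in> \<Inter>(?H x')" by blast
          then show False using maximal[of x z] maximal[of x' z] ne(1) by simp
        qed
      qed
      moreover have "|\<U>| \<le>o |?\<V>|"
      proof (rule card_of_ordLeq_finite_fibres[OF False, where G = "\<lambda>W. {U\<in>\<U>. W \<subseteq> U}"])
        show "finite {U\<in>\<U>. W \<subseteq> U}" if "W \<in> ?\<V>" for W
        proof -
          obtain x where x: "W = \<Inter>(?H x)" using \<open>W \<in> ?\<V>\<close> by blast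
          then have "x \<in> W" by blast
          then have "{U\<in>\<U>. W \<subseteq> U} \<subseteq> ?H x" by blast
          then show ?thesis using k(1) finite_subset by blast
        qed
        show "\<U> \<subseteq> (\<Union>W\<in>?\<V>. {U\<in>\<U>. W \<subseteq> U})"
        proof
          fix U assume U: "U \<in> \<U>"
          then have "\<exists>x. x \<in> U" using \<U> by (auto simp: pb_family_def)
          moreover have "\<forall>x. x \<in> U \<longrightarrow> card (?H x) < Suc k" using k(2) by (simp add: le_imp_less_Suc)
          ultimately obtain x where x: "x \<in> U" "\<forall>z. z \<in> U \<longrightarrow> card (?H z) \<le> card (?H x)"
            using ex_has_greatest_nat[of "\<lambda>x. x \<in> U" _ "\<lambda>x. card (?H x)" "Suc k"] by blast
          have "?H z = ?H x" if "?H x \<subseteq> ?H z" for z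
          proof -
            have "z \<in> U" using that U x(1) by blast
            then show ?thesis using card_seteq[OF k(1) that] x(2) by simp
          qed
          then have "x \<in> X" using U x(1) by (auto simp: X_def)
          moreover have "\<Inter>(?H x) \<subseteq> U" using U x(1) by blast
          ultimately show "U \<in> (\<Union>W\<in>?\<V>. {U\<in>\<U>. W \<subseteq> U})" using U by blast
        qed
      qed
      ultimately show ?thesis using ordLeq_transitive by blast
    qed
  qed
  ultimately show ?thesis by (simp add: ordIso_iff_ordLeq)
qed

definition dense_in_itself_kernel :: "'a::topological_space set" where
  "dense_in_itself_kernel = \<Union>{P. P \<subseteq> derived P}"

lemma dense_in_itself_kernel_subset_derived:
  "(dense_in_itself_kernel :: 'a::topological_space set) \<subseteq> derived dense_in_itself_kernel"
proof
  fix x :: 'a assume "x \<in> dense_in_itself_kernel"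
  then obtain P where P: "x \<in> P" "P \<subseteq> derived P" unfolding dense_in_itself_kernel_def by blast
  then have "P \<subseteq> dense_in_itself_kernel" unfolding dense_in_itself_kernel_def by blast
  then show "x \<in> derived dense_in_itself_kernel" using derived_mono P by blast
qed

lemma dense_in_itself_kernel_subset:
  fixes r :: "'o rel"
  assumes WO: "Well_order r"
  shows "(dense_in_itself_kernel :: 'a::topological_space set) \<subseteq> rel_derivative r UNIV a"
proof (induction a rule: Well_order_underS_induct[OF WO])
  case (1 a)
  have "(dense_in_itself_kernel :: 'a set) \<subseteq> derived (rel_derivative r UNIV b)" if "b \<in> underS r a" for b
    using dense_in_itself_kernel_subset_derived derived_mono[OF 1[OF that]] by blast
  then show ?case
    unfolding rel_derivative_unfold[OF WO, of _ a] by blast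
qed

lemma rel_derivative_stabilizes:
  fixes r :: "'o rel"
  assumes WO: "Well_order r" and noinj: "\<nexists>f :: 'o \<Rightarrow> 'a::topological_space. inj_on f (Field r)"
  shows "\<exists>a\<in>Field r. \<forall>b. (a, b) \<in> r \<longrightarrow> rel_derivative r UNIV b = (dense_in_itself_kernel :: 'a set)"
proof -
  let ?D = "rel_derivative r (UNIV :: 'a set)"
  have "\<exists>a\<in>Field r. ?D a \<subseteq> derived (?D a)"
  proof (rule ccontr)
    assume "\<not> ?thesis"
    then have "\<forall>a\<in>Field r. \<exists>x. x \<in> ?D a \<and> x \<notin> derived (?D a)" by blast
    then obtain p where p: "\<And>a. a \<in> Field r \<Longrightarrow> p a \<in> ?D a \<and> p a \<notin> derived (?D a)" by metis
    have ne: "p a \<noteq> p b" if "a \<in> underS r b" for a b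
    proof -
      have "a \<in> Field r" "b \<in> Field r" using that by (auto simp: underS_def Field_def)
      then show ?thesis
        using p[of a] p[of b] rel_derivative_subset_derived[OF WO that, of "UNIV :: 'a set"] by auto
    qed
    have "inj_on p (Field r)"
    proof (rule inj_onI)
      fix a b assume "a \<in> Field r" "b \<in> Field r" "p a = p b"
      then show "a = b"
        using ne[of a b] ne[of b a] underS_linear[OF WO, of a b] by metis
    qed
    then show False using noinj by blast
  qed
  then obtain a where a: "a \<in> Field r" "?D a \<subseteq> derived (?D a)" by blast
  then have "?D a \<subseteq> dense_in_itself_kernel" unfolding dense_in_itself_kernel_def by blast
  then have "?D b = dense_in_itself_kernel" if "(a, b) \<in> r" for b
    using rel_derivative_antimono[OF WO that, of "UNIV :: 'a set"] dense_in_itself_kernel_subset[OF WO, of b]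
    by blast
  then show ?thesis using a(1) by blast
qed

lemma no_inj_from_powerset: "\<nexists>f :: 'a set \<Rightarrow> 'a. inj f"
proof
  assume "\<exists>f :: 'a set \<Rightarrow> 'a. inj f"
  then obtain f :: "'a set \<Rightarrow> 'a" where "inj f" by blast
  then have "range (inv_into UNIV f) = Pow UNIV" by (simp add: inj_imp_surj_inv)
  then show False using Cantors_theorem[of "UNIV :: 'a set"] by blast
qed

lemma perfect_kernel_eq: "(perfect_kernel :: 'a::topological_space set) = dense_in_itself_kernel"
proof -
  let ?r = "|UNIV :: 'a set set|"
  let ?D = "cb_derivative ?r :: 'a set \<Rightarrow> 'a set"
  have WO: "Well_order ?r" by (rule card_of_Well_order)
  have "\<nexists>f :: 'a set \<Rightarrow> 'a. inj_on f (Field ?r)"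
    using no_inj_from_powerset by simp
  from rel_derivative_stabilizes[OF WO this]
  obtain a where a: "a \<in> Field ?r" "\<And>b. (a, b) \<in> ?r \<Longrightarrow> ?D b = dense_in_itself_kernel"
    by (auto simp: cb_derivative_eq_rel_derivative[OF WO])
  have "wo_rel ?r" using WO by (simp add: wo_rel_def)
  then have total: "(x, y) \<in> ?r \<or> (y, x) \<in> ?r" for x y :: "'a set"
    using wo_rel.TOTALS by fastforce
  then have refl: "(x, x) \<in> ?r" for x :: "'a set" by blast
  show ?thesis
    unfolding perfect_kernel_def Let_def
  proof (rule the_equality)
    show "\<exists>a\<in>Field ?r. ?D a = dense_in_itself_kernel \<and>
        (\<forall>b. (a, b) \<in> ?r \<longrightarrow> ?D b = dense_in_itself_kernel)"
      using a refl by blast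
    fix S assume "\<exists>a\<in>Field ?r. ?D a = S \<and> (\<forall>b. (a, b) \<in> ?r \<longrightarrow> ?D b = S)"
    then obtain a' where a': "?D a' = S" "\<And>b. (a', b) \<in> ?r \<Longrightarrow> ?D b = S" by blast
    then show "S = dense_in_itself_kernel"
      using total[of a a'] a(2)[of a'] a(2)[OF refl] a'(2)[of a] by auto
  qed
qed

lemma bounded_linear_if_continuous:
  fixes T :: "'v::real_normed_vector \<Rightarrow> 'w::real_normed_vector"
  assumes "linear T" "continuous_on UNIV T"
  shows "bounded_linear T"
proof -
  have "isCont T 0" using assms(2) by (simp add: continuous_on_eq_continuous_at)
  then obtain d where d: "d > 0" "\<And>x. dist x 0 < d \<Longrightarrow> dist (T x) (T 0) < 1"
    unfolding continuous_at_eps_delta by (metis zero_less_one)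
  have T0: "T 0 = 0" using assms(1) by (rule linear_0)
  show ?thesis
  proof (rule bounded_linear_intro[where K = "2 / d"])
    show "T (x + y) = T x + T y" for x y using assms(1) by (rule linear_add)
    show "T (t *\<^sub>R x) = t *\<^sub>R T x" for t x using assms(1) by (rule linear_scale)
    show "norm (T x) \<le> norm x * (2 / d)" for x
    proof (cases "x = 0")
      case False
      let ?t = "d / (2 * norm x)"
      have "norm (?t *\<^sub>R x) < d" using d(1) False by simp
      then have "norm (T (?t *\<^sub>R x)) < 1" using d(2)[of "?t *\<^sub>R x"] T0 by simp
      then have "?t * norm (T x) < 1" using d(1) False assms(1) by (simp add: linear_scale)
      then show ?thesis using d(1) False by (simp add: field_simps)
    qed (simp add: T0)
  qed
qed

lemma cotype_embedding_of_bounded_linear: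
  fixes T :: "('k::t2_space \<Rightarrow>\<^sub>C 'e1::real_normed_vector) \<Rightarrow> ('l::t2_space \<Rightarrow>\<^sub>C 'e2::real_normed_vector)"
  assumes "bounded_linear T" "bounded_linear S" "\<And>f. S (T f) = f"
    and "compact (UNIV :: 'k set)" "compact (UNIV :: 'l set)" "\<exists>x :: 'e1. x \<noteq> 0"
    and "nontrivial_cotype TYPE('e2)"
  shows "\<exists>(F :: ('k \<Rightarrow> real) \<Rightarrow> 'l \<Rightarrow> 'e2) M c. cotype_embedding F M c"
proof -
  interpret T: bounded_linear T by fact
  interpret S: bounded_linear S by fact
  obtain K where K: "K > 0" "\<And>f. norm (T f) \<le> norm f * K" using T.pos_bounded by blast
  obtain L where L: "L > 0" "\<And>f. norm (S f) \<le> norm f * L" using S.pos_bounded by blast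
  obtain e :: 'e1 where e: "norm e = 1" using assms(6) by (metis norm_sgn)
  define E where "E = (\<lambda>\<phi>::'k \<Rightarrow> real. Bcontfun (\<lambda>x. \<phi> x *\<^sub>R e))"
  have E: "apply_bcontfun (E \<phi>) x = \<phi> x *\<^sub>R e" if "continuous_on UNIV \<phi>" for \<phi> x
  proof -
    have c: "continuous_on UNIV (\<lambda>x. \<phi> x *\<^sub>R e)" using that by (intro continuous_intros)
    then have "bounded (range (\<lambda>x. \<phi> x *\<^sub>R e))"
      using compact_imp_bounded compact_continuous_image assms(4) by blast
    then show ?thesis using c by (simp add: E_def Bcontfun_inverse bcontfun_def)
  qed
  have "cotype_embedding (\<lambda>\<phi>. apply_bcontfun (T (E \<phi>))) K L"
  proof
    fix \<phi> \<psi> :: "'k \<Rightarrow> real" and y t and b :: real and x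
    assume \<phi>: "continuous_on UNIV \<phi>"
    show "continuous_on UNIV (apply_bcontfun (T (E \<phi>)))" by simp
    have "E (\<lambda>x. t * \<phi> x) = t *\<^sub>R E \<phi>"
      using \<phi> by (intro bcontfun_eqI) (simp add: E continuous_on_mult_left)
    then show "apply_bcontfun (T (E (\<lambda>x. t * \<phi> x))) y = t *\<^sub>R apply_bcontfun (T (E \<phi>)) y"
      by (simp add: T.scaleR)
    {
      assume \<psi>: "continuous_on UNIV \<psi>"
      have "E (\<lambda>x. \<phi> x + \<psi> x) = E \<phi> + E \<psi>"
        using \<phi> \<psi> by (intro bcontfun_eqI) (simp add: E continuous_on_add scaleR_add_left)
      then show "apply_bcontfun (T (E (\<lambda>x. \<phi> x + \<psi> x))) y
          = apply_bcontfun (T (E \<phi>)) y + apply_bcontfun (T (E \<psi>)) y"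
        by (simp add: T.add)
    }
    {
      assume "\<And>x. \<bar>\<phi> x\<bar> \<le> b"
      then have "norm (E \<phi>) \<le> b" using \<phi> e by (intro norm_bound) (simp add: E)
      then have "norm (T (E \<phi>)) \<le> K * b"
        using K(2)[of "E \<phi>"] K(1) mult_right_mono[of "norm (E \<phi>)" b K]
        by (simp add: mult.commute order_trans)
      then show "norm (apply_bcontfun (T (E \<phi>)) y) \<le> K * b"
        using norm_bounded order_trans by blast
    }
    {
      assume "\<And>y. norm (apply_bcontfun (T (E \<phi>)) y) \<le> b"
      then have "norm (T (E \<phi>)) \<le> b" by (rule norm_bound)
      then have "norm (T (E \<phi>)) * L \<le> L * b" using L(1) by simp
      then have "norm (E \<phi>) \<le> L * b" using L(2)[of "T (E \<phi>)"] assms(3) by simp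
      then show "\<bar>\<phi> x\<bar> \<le> L * b"
        using norm_bounded[of "E \<phi>" x] \<phi> e by (simp add: E)
    }
  qed (use assms K L in auto)
  then show ?thesis by blast
qed

section \<open>Comparison of the invariants\<close>

lemma card_min_c_pb_ordLeq:
  fixes T :: "('k::t2_space \<Rightarrow>\<^sub>C 'e1::real_normed_vector) \<Rightarrow> ('l::t2_space \<Rightarrow>\<^sub>C 'e2::real_normed_vector)"
  assumes "bounded_linear T" "bounded_linear S" "\<And>f. S (T f) = f"
    and "compact (UNIV :: 'k set)" "compact (UNIV :: 'l set)" "\<exists>x :: 'e1. x \<noteq> 0"
    and "nontrivial_cotype TYPE('e2)" and "infinite (UNIV :: 'l set)" and "Well_order \<alpha>"
  shows "card_min {c_pb (cb_derivative (omega_power \<alpha>) \<beta> :: 'k set) |\<beta>. \<beta> \<in> Field (omega_power \<alpha>)}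
     \<le>o card_min {c_pb (cb_derivative (omega_power \<alpha>) \<beta> :: 'l set) |\<beta>. \<beta> \<in> Field (omega_power \<alpha>)}"
proof (rule card_min_ordLeq)
  obtain F :: "('k \<Rightarrow> real) \<Rightarrow> 'l \<Rightarrow> 'e2" and M c where "cotype_embedding F M c"
    using cotype_embedding_of_bounded_linear[OF assms(1-7)] by blast
  then show "\<exists>c\<in>{c_pb (cb_derivative (omega_power \<alpha>) \<beta> :: 'k set) |\<beta>. \<beta> \<in> Field (omega_power \<alpha>)}. c \<le>o c'"
    if "c' \<in> {c_pb (cb_derivative (omega_power \<alpha>) \<beta> :: 'l set) |\<beta>. \<beta> \<in> Field (omega_power \<alpha>)}" for c'
    using that cotype_embedding.c_pb_rel_derivative_ordLeq[OF _ assms(8,9)] by blast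
qed (use zero_Field_omega_power Card_order_c_pb in blast)+

lemma card_min_c_pb_eq_perfect_kernel:
  fixes \<alpha> :: "'o rel"
  assumes WO: "Well_order \<alpha>" and noinj: "\<nexists>f :: 'o \<Rightarrow> 'a::topological_space. inj_on f (Field \<alpha>)"
  shows "card_min {c_pb (cb_derivative (omega_power \<alpha>) \<beta> :: 'a::topological_space set) |\<beta>. \<beta> \<in> Field (omega_power \<alpha>)}
     =o c_pb (perfect_kernel :: 'a::topological_space set)"
proof -
  note W = Well_order_omega_power[OF WO]
  let ?C = "{c_pb (cb_derivative (omega_power \<alpha>) \<beta> :: 'a set) |\<beta>. \<beta> \<in> Field (omega_power \<alpha>)}"
  have ne: "?C \<noteq> {}" using zero_Field_omega_power by blast
  have co: "Card_order c" if "c \<in> ?C" for c using that Card_order_c_pb by blast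
  have "\<nexists>f :: ('o \<Rightarrow> nat) \<Rightarrow> 'a. inj_on f (Field (omega_power \<alpha>))"
  proof
    assume "\<exists>f :: ('o \<Rightarrow> nat) \<Rightarrow> 'a. inj_on f (Field (omega_power \<alpha>))"
    then obtain f :: "('o \<Rightarrow> nat) \<Rightarrow> 'a" where f: "inj_on f (Field (omega_power \<alpha>))" by blast
    have "inj_on (omega_pow :: 'o \<Rightarrow> 'o \<Rightarrow> nat) (Field \<alpha>)"
      by (rule inj_onI) (metis omega_pow_simps zero_neq_one)
    moreover have "omega_pow ` Field \<alpha> \<subseteq> Field (omega_power \<alpha>)" by (rule image_subsetI[OF omega_pow_Field])
    ultimately have "inj_on (f \<circ> omega_pow) (Field \<alpha>)"
      using f by (meson comp_inj_on inj_on_subset)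
    then show False using noinj by blast
  qed
  from rel_derivative_stabilizes[OF W this]
  obtain a where a: "a \<in> Field (omega_power \<alpha>)"
      "\<forall>b. (a, b) \<in> omega_power \<alpha> \<longrightarrow> rel_derivative (omega_power \<alpha>) UNIV b = (dense_in_itself_kernel :: 'a set)"
    by blast
  have "(a, a) \<in> omega_power \<alpha>" using a(1) by (simp add: omega_power_iff)
  then have "cb_derivative (omega_power \<alpha>) a = (perfect_kernel :: 'a set)"
    using a(2) by (simp add: cb_derivative_eq_rel_derivative[OF W] perfect_kernel_eq)
  then have "c_pb (perfect_kernel :: 'a set) \<in> ?C"
    using a(1) by (intro CollectI exI[of _ a]) simp
  then have "card_min ?C \<le>o c_pb (perfect_kernel :: 'a set)"
    using card_min_least(2)[OF ne co] by blast
  moreover have "c_pb (perfect_kernel :: 'a set) \<le>o c" if "c \<in> ?C" for c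
    using that c_pb_mono[OF dense_in_itself_kernel_subset[OF W]]
    by (auto simp: cb_derivative_eq_rel_derivative[OF W] perfect_kernel_eq)
  then have "c_pb (perfect_kernel :: 'a set) \<le>o card_min ?C"
    using card_min_least(1)[OF ne co] by blast
  ultimately show ?thesis by (simp add: ordIso_iff_ordLeq)
qed

lemma card_min_c_pb_empty:
  "card_min {c_pb (cb_derivative (omega_power ({} :: 'o rel)) \<beta> :: 'a::topological_space set) |\<beta>. \<beta> \<in> Field (omega_power ({} :: 'o rel))}
     = c_pb (UNIV :: 'a set)"
proof -
  have WO: "Well_order ({} :: 'o rel)" by simp
  have "Field (omega_power ({} :: 'o rel)) = {\<lambda>_. 0}"
    unfolding Field_omega_power by auto
  moreover have "cb_derivative (omega_power ({} :: 'o rel)) (\<lambda>_. 0) = (UNIV :: 'a set)"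
    using rel_derivative_zero[OF WO] cb_derivative_eq_rel_derivative[OF Well_order_omega_power[OF WO]] by metis
  ultimately have "{c_pb (cb_derivative (omega_power ({} :: 'o rel)) \<beta> :: 'a set) |\<beta>. \<beta> \<in> Field (omega_power ({} :: 'o rel))}
      = {c_pb UNIV}" by simp
  then show ?thesis
    using card_min_least(1)[of "{c_pb (UNIV :: 'a set)}"] Card_order_c_pb by auto
qed

lemma card_min_c_pb_eq:
  assumes "compact (UNIV :: 'k1::t2_space set)" and "infinite (UNIV :: 'k1::t2_space set)"
    and "compact (UNIV :: 'k2::t2_space set)" and "infinite (UNIV :: 'k2::t2_space set)"
    and "\<exists>x :: 'e1::banach. x \<noteq> 0" and "\<exists>x :: 'e2::banach. x \<noteq> 0"
    and "nontrivial_cotype TYPE('e1::banach)" and "nontrivial_cotype TYPE('e2::banach)"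
    and "isomorphic_normed TYPE('k1::t2_space \<Rightarrow>\<^sub>C 'e1::banach) TYPE('k2::t2_space \<Rightarrow>\<^sub>C 'e2::banach)" and WO: "Well_order \<alpha>"
  shows "card_min {c_pb (cb_derivative (omega_power \<alpha>) \<beta> :: 'k1::t2_space set) |\<beta>. \<beta> \<in> Field (omega_power \<alpha>)}
      =o card_min {c_pb (cb_derivative (omega_power \<alpha>) \<beta> :: 'k2::t2_space set) |\<beta>. \<beta> \<in> Field (omega_power \<alpha>)}"
proof -
  obtain T :: "('k1 \<Rightarrow>\<^sub>C 'e1) \<Rightarrow> ('k2 \<Rightarrow>\<^sub>C 'e2)" and S where T: "linear T" and h: "homeomorphism UNIV UNIV T S"
    using assms(9) unfolding isomorphic_normed_def by blast
  have ST: "S (T f) = f" and TS: "T (S g) = g" for f g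
    using h by (simp_all add: homeomorphism_def)
  have bT: "bounded_linear T"
    using T h by (intro bounded_linear_if_continuous) (simp_all add: homeomorphism_def)
  have "linear S"
    using T ST TS by (intro linearI) (metis linear_add, metis linear_scale)
  then have bS: "bounded_linear S"
    using h by (intro bounded_linear_if_continuous) (simp_all add: homeomorphism_def)
  show ?thesis
    unfolding ordIso_iff_ordLeq
    using card_min_c_pb_ordLeq[OF bT bS ST assms(1,3,5,8,4) WO]
      card_min_c_pb_ordLeq[OF bS bT TS assms(3,1,6,7,2) WO] by blast
qed

theorem corollary1p4:
  assumes "compact (UNIV :: 'k1::t2_space set)" and "infinite (UNIV :: 'k1::t2_space set)"
    and "compact (UNIV :: 'k2::t2_space set)" and "infinite (UNIV :: 'k2::t2_space set)"
    and "\<exists>x :: 'e1::banach. x \<noteq> 0" and "\<exists>x :: 'e2::banach. x \<noteq> 0"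
    and "nontrivial_cotype TYPE('e1::banach)" and "nontrivial_cotype TYPE('e2::banach)"
    and "isomorphic_normed TYPE('k1::t2_space \<Rightarrow>\<^sub>C 'e1::banach) TYPE('k2::t2_space \<Rightarrow>\<^sub>C 'e2::banach)"
  shows "(\<forall>\<alpha> :: 'o rel. Well_order \<alpha> \<longrightarrow>
            card_min {c_pb (cb_derivative (omega_power \<alpha>) \<beta> :: 'k1::t2_space set) |\<beta>. \<beta> \<in> Field (omega_power \<alpha>)}
         =o card_min {c_pb (cb_derivative (omega_power \<alpha>) \<beta> :: 'k2::t2_space set) |\<beta>. \<beta> \<in> Field (omega_power \<alpha>)})
       \<and> cellularity TYPE('k1::t2_space) =o cellularity TYPE('k2::t2_space)
       \<and> c_pb (perfect_kernel :: 'k1::t2_space set) =o c_pb (perfect_kernel :: 'k2::t2_space set)"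
proof (intro conjI allI impI)
  note main = card_min_c_pb_eq[OF assms]
  show "card_min {c_pb (cb_derivative (omega_power \<alpha>) \<beta> :: 'k1 set) |\<beta>. \<beta> \<in> Field (omega_power \<alpha>)}
      =o card_min {c_pb (cb_derivative (omega_power \<alpha>) \<beta> :: 'k2 set) |\<beta>. \<beta> \<in> Field (omega_power \<alpha>)}"
    if "Well_order \<alpha>" for \<alpha> :: "'o rel"
    by (rule main[OF that])
  have "c_pb (UNIV :: 'k1 set) =o c_pb (UNIV :: 'k2 set)"
    using main[of "{} :: nat rel"] unfolding card_min_c_pb_empty by simp
  then show "cellularity TYPE('k1) =o cellularity TYPE('k2)"
    using ordIso_transitive[OF ordIso_symmetric[OF c_pb_UNIV_eq_cellularity[OF assms(2)]]]
      ordIso_transitive c_pb_UNIV_eq_cellularity[OF assms(4)] by metis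
  let ?\<alpha> = "|UNIV :: ('k1 + 'k2) set set|"
  have WO: "Well_order ?\<alpha>" by (rule card_of_Well_order)
  have "\<nexists>f :: ('k1 + 'k2) set \<Rightarrow> 'k1. inj_on f (Field ?\<alpha>)"
  proof
    assume "\<exists>f :: ('k1 + 'k2) set \<Rightarrow> 'k1. inj_on f (Field ?\<alpha>)"
    then obtain f :: "('k1 + 'k2) set \<Rightarrow> 'k1" where "inj f" by auto
    then have "inj ((Inl :: 'k1 \<Rightarrow> 'k1 + 'k2) \<circ> f)" by (intro inj_compose) simp_all
    then show False using no_inj_from_powerset by blast
  qed
  note eq1 = card_min_c_pb_eq_perfect_kernel[OF WO this]
  have "\<nexists>f :: ('k1 + 'k2) set \<Rightarrow> 'k2. inj_on f (Field ?\<alpha>)"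
  proof
    assume "\<exists>f :: ('k1 + 'k2) set \<Rightarrow> 'k2. inj_on f (Field ?\<alpha>)"
    then obtain f :: "('k1 + 'k2) set \<Rightarrow> 'k2" where "inj f" by auto
    then have "inj ((Inr :: 'k2 \<Rightarrow> 'k1 + 'k2) \<circ> f)" by (intro inj_compose) simp_all
    then show False using no_inj_from_powerset by blast
  qed
  note eq2 = card_min_c_pb_eq_perfect_kernel[OF WO this]
  show "c_pb (perfect_kernel :: 'k1 set) =o c_pb (perfect_kernel :: 'k2 set)"
    using ordIso_transitive[OF ordIso_symmetric[OF eq1] ordIso_transitive[OF main[OF WO] eq2]] .
qed

end
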